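(* Let $(p,q)$ be a pair of polynomials of degrees $m$ and $n$, respectively, with a greatest common divisor (GCD) of degree $k$. Define $$\mathbf{f}:\mathcal{P}_k\times\mathcal{P}_{m-k}\times\mathcal{P}_{n-k}\times\mathcal{P}_m\times\mathcal{P}_n\to\mathcal{P}_m\times\mathcal{P}_n,\qquad (u,v,w,f,g)\mapsto (uv-f,\;uw-g).$$ Assume the data $(\tilde p,\tilde q)$ is sufficiently close to $(p,q)$ and the initial iterate $(u_0,v_0,w_0)$ is sufficiently close to a zero $(\hat u,\hat v,\hat w)$ of the mapping $\mathbf{g}:(u,v,w)\mapsto\mathbf{f}(u,v,w,p,q)$. Setting $r=m+n-k+2$, the rank-$r$ Newton's iteration $$(u_{j+1},v_{j+1},w_{j+1})=(u_j,v_j,w_j)-\mathbf{f}_{uvw}(u_j,v_j,w_j,\tilde p,\tilde q)_{\text{rank-}r}^{\dagger}\,\mathbf{f}(u_j,v_j,w_j,\tilde p,\tilde q),\qquad j=0,1,\ldots$$ at the data $(\tilde p,\tilde q)$ converges to some $(\tilde u,\tilde v,\tilde w)$ with the error bound $$\big\|(\tilde u,\tilde v,\tilde w)-(\check u,\check v,\check w)\big\|\le c\,\big\|\mathbf{f}_{uvw}(\hat u,\hat v,\hat w,p,q)_{\text{rank-}r}^{\dagger}\big\|\,\big\|(\tilde p,\tilde q)-(p,q)\big\|+h.o.t.,$$ where $(\check u,\check v,\check w)\in\mathbf{g}^{-1}(\mathbf{0})$ is an exact GCD triple of $(p,q)$, $c>0$ is a constant of moderate magnitude, and $h.o.t.$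 represents higher order terms of the data error. The convergence rate is quadratic if the data $(\tilde p,\tilde q)=(p,q)$. The GCD condition number at the polynomial pair $(p,q)$ can be defined as $\big\|\mathbf{f}_{uvw}(\hat u,\hat v,\hat w,p,q)_{\text{rank-}r}^{\dagger}\big\|$.
   Context: $\mathcal{P}_l$ is the vector space of univariate complex polynomials of degree at most $l$, normed by the Euclidean norm of the coefficient vector, so that $\mathcal{P}_l$ is isometrically isomorphic to $\mathbb{C}^{l+1}$. A product space carries the norm given by the square root of the sum of the squared component norms, and linear maps carry the operator norm. $\mathbf{f}_{uvw}$ denotes the partial Jacobian of $\mathbf{f}$ with respect to $(u,v,w)$, as a linear map from $\mathcal{P}_k\times\mathcal{P}_{m-k}\times\mathcal{P}_{n-k}$ to $\mathcal{P}_m\times\mathcal{P}_n$. For a matrix $A$, the rank-$r$ projection $A_{\text{rank-}r}$ is the rank-$r$ matrix with the smallest Frobenius distance to $A$ (the rank-$r$ truncated SVD), and $A_{\text{rank-}r}^{\dagger}$ is the Moore–Penrose inverse of $A_{\text{rank-}r}$. For linear maps, the rank-$r$ projection and its Moore–Penrose inverse are defined through the matrix representation with respect to isometric isomorphisms with $\mathbb{C}^N$ and $\mathbb{C}^M$. A zero $(u,v,w)$ of $\mathbf{g}$ satisfies $uv=p$ and $uw=q$. An exact GCD triple of $(p,q)$ is such a triple in which $u$ is a constant multiple of the GCD of $p$ and $q$ and $(v,w)$ is the corresponding pair of cofactors. The pair $(\tilde p,\tilde q)\in\mathcal{P}_m\times\mathcal{P}_n$ serves as empirical data for $(p,q)$.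 *)

theory Defs
  imports
    "HOL-Analysis.Analysis"
    "HOL-Computational_Algebra.Polynomial_Factorial"
    "HOL-Computational_Algebra.Field_as_Ring"
    "Jordan_Normal_Form.DL_Rank"
    "Jordan_Normal_Form.Schur_Decomposition"
begin

hide_type (open) Finite_Cartesian_Product.vec
hide_const (open) Finite_Cartesian_Product.vec Finite_Cartesian_Product.mat
  Finite_Cartesian_Product.row Finite_Cartesian_Product.column
unbundle no vec_syntax

definition euclid_norm :: "complex vec \<Rightarrow> real" where
  "euclid_norm x = sqrt (\<Sum>i<dim_vec x. (cmod (x $ i))\<^sup>2)"

definition frobenius_norm :: "complex mat \<Rightarrow> real" where
  "frobenius_norm A = sqrt (\<Sum>i<dim_row A. \<Sum>j<dim_col A. (cmod (A $$ (i, j)))\<^sup>2)"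

definition op_norm :: "complex mat \<Rightarrow> real" where
  "op_norm A = (SUP x \<in> {x \<in> carrier_vec (dim_col A). euclid_norm x \<le> 1}. euclid_norm (A *\<^sub>v x))"

text \<open>Rank exactly \<open>r\<close> and closest to \<open>A\<close> in the Frobenius norm. A closest matrix is unique when
  the \<open>r\<close>-th singular value of \<open>A\<close> exceeds the next one; in case of a tie the function below
  selects one of the closest matrices.\<close>

definition is_rank_projection :: "nat \<Rightarrow> complex mat \<Rightarrow> complex mat \<Rightarrow> bool" where
  "is_rank_projection r A =
     is_arg_min (\<lambda>B. frobenius_norm (A - B))
       (\<lambda>B. B \<in> carrier_mat (dim_row A) (dim_col A) \<and> vec_space.rank (dim_row A) B = r)"

definition rank_projection :: "nat \<Rightarrow> complex mat \<Rightarrow> complex mat" where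
  "rank_projection r A = (SOME B. is_rank_projection r A B)"

definition is_moore_penrose_inverse :: "complex mat \<Rightarrow> complex mat \<Rightarrow> bool" where
  "is_moore_penrose_inverse A X \<longleftrightarrow>
     X \<in> carrier_mat (dim_col A) (dim_row A) \<and>
     A * X * A = A \<and> X * A * X = X \<and>
     mat_adjoint (A * X) = A * X \<and> mat_adjoint (X * A) = X * A"

definition moore_penrose_inverse :: "complex mat \<Rightarrow> complex mat" where
  "moore_penrose_inverse A = (THE X. is_moore_penrose_inverse A X)"

definition rank_pinv :: "nat \<Rightarrow> complex mat \<Rightarrow> complex mat" where
  "rank_pinv r A = moore_penrose_inverse (rank_projection r A)"

text \<open>The \<open>M \<times> N\<close> matrix of complex partial derivatives at \<open>x\<close> of a map from
  \<open>N\<close>-dimensional to \<open>M\<close>-dimensional complex coordinate space.\<close>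

definition jacobian_matrix ::
    "nat \<Rightarrow> nat \<Rightarrow> (complex vec \<Rightarrow> complex vec) \<Rightarrow> complex vec \<Rightarrow> complex mat" where
  "jacobian_matrix M N F x =
     mat M N (\<lambda>(i, j). deriv (\<lambda>t. F (x + t \<cdot>\<^sub>v unit_vec N j) $ i) 0)"

type_synonym poly_pair = "complex poly \<times> complex poly"
type_synonym poly_triple = "complex poly \<times> complex poly \<times> complex poly"

definition poly_space :: "nat \<Rightarrow> complex poly set" where
  "poly_space l = {f. degree f \<le> l}"

definition poly_norm :: "complex poly \<Rightarrow> real" where
  "poly_norm f = sqrt (\<Sum>i\<le>degree f. (cmod (coeff f i))\<^sup>2)"

fun pair_norm :: "poly_pair \<Rightarrow> real" where
  "pair_norm (f, g) = sqrt ((poly_norm f)\<^sup>2 + (poly_norm g)\<^sup>2)"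

fun triple_norm :: "poly_triple \<Rightarrow> real" where
  "triple_norm (u, v, w) = sqrt ((poly_norm u)\<^sup>2 + (poly_norm v)\<^sup>2 + (poly_norm w)\<^sup>2)"

definition triple_space :: "nat \<Rightarrow> nat \<Rightarrow> nat \<Rightarrow> poly_triple set" where
  "triple_space k m n = poly_space k \<times> poly_space (m - k) \<times> poly_space (n - k)"

definition pair_space :: "nat \<Rightarrow> nat \<Rightarrow> poly_pair set" where
  "pair_space m n = poly_space m \<times> poly_space n"

text \<open>The isometric isomorphisms with complex coordinate spaces, given by the monomial bases.\<close>

definition coeff_vec :: "nat \<Rightarrow> complex poly \<Rightarrow> complex vec" where
  "coeff_vec l f = vec (l + 1) (coeff f)"

definition vec_poly :: "complex vec \<Rightarrow> complex poly" where
  "vec_poly x = (\<Sum>i<dim_vec x. monom (x $ i) i)"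

fun pair_vec :: "nat \<Rightarrow> nat \<Rightarrow> poly_pair \<Rightarrow> complex vec" where
  "pair_vec m n (f, g) = coeff_vec m f @\<^sub>v coeff_vec n g"

fun triple_vec :: "nat \<Rightarrow> nat \<Rightarrow> nat \<Rightarrow> poly_triple \<Rightarrow> complex vec" where
  "triple_vec k m n (u, v, w) =
     coeff_vec k u @\<^sub>v coeff_vec (m - k) v @\<^sub>v coeff_vec (n - k) w"

definition vec_triple :: "nat \<Rightarrow> nat \<Rightarrow> nat \<Rightarrow> complex vec \<Rightarrow> poly_triple" where
  "vec_triple k m n x =
     (vec_poly (vec (k + 1) (\<lambda>i. x $ i)),
      vec_poly (vec (m - k + 1) (\<lambda>i. x $ (k + 1 + i))),
      vec_poly (vec (n - k + 1) (\<lambda>i. x $ (k + 1 + (m - k + 1) + i))))"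

fun gcd_map :: "poly_triple \<Rightarrow> poly_pair \<Rightarrow> poly_pair" where
  "gcd_map (u, v, w) (f, g) = (u * v - f, u * w - g)"

definition gcd_jacobian ::
    "nat \<Rightarrow> nat \<Rightarrow> nat \<Rightarrow> poly_triple \<Rightarrow> poly_pair \<Rightarrow> complex mat" where
  "gcd_jacobian k m n z d =
     jacobian_matrix ((m + 1) + (n + 1)) ((k + 1) + (m - k + 1) + (n - k + 1))
       (\<lambda>x. pair_vec m n (gcd_map (vec_triple k m n x) d)) (triple_vec k m n z)"

primrec newton_iterate ::
    "nat \<Rightarrow> nat \<Rightarrow> nat \<Rightarrow> nat \<Rightarrow> poly_pair \<Rightarrow> poly_triple \<Rightarrow> nat \<Rightarrow> poly_triple" where
  "newton_iterate r k m n d z 0 = z"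
| "newton_iterate r k m n d z (Suc j) =
     (let y = newton_iterate r k m n d z j in
      y - vec_triple k m n
            (rank_pinv r (gcd_jacobian k m n y d) *\<^sub>v pair_vec m n (gcd_map y d)))"

definition gcd_zeros :: "nat \<Rightarrow> nat \<Rightarrow> nat \<Rightarrow> poly_pair \<Rightarrow> poly_triple set" where
  "gcd_zeros k m n d = {z \<in> triple_space k m n. gcd_map z d = (0, 0)}"

fun exact_gcd_triple :: "poly_pair \<Rightarrow> poly_triple \<Rightarrow> bool" where
  "exact_gcd_triple (p, q) (u, v, w) \<longleftrightarrow>
     (\<exists>a. a \<noteq> 0 \<and> u = Polynomial.smult a (gcd p q)) \<and> p = u * v \<and> q = u * w"

text \<open>The condition number is taken with respect to a zero \<open>z\<close>, on whose scaling it depends.\<close>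

fun gcd_condition_number :: "poly_pair \<Rightarrow> poly_triple \<Rightarrow> real" where
  "gcd_condition_number (p, q) z =
     (let m = degree p; n = degree q; k = degree (gcd p q)
      in op_norm (rank_pinv (m + n - k + 2) (gcd_jacobian k m n z (p, q))))"

definition triple_converges :: "(nat \<Rightarrow> poly_triple) \<Rightarrow> poly_triple \<Rightarrow> bool" where
  "triple_converges s z \<longleftrightarrow> (\<lambda>j. triple_norm (s j - z)) \<longlonglongrightarrow> 0"

definition quadratic_rate :: "(nat \<Rightarrow> poly_triple) \<Rightarrow> poly_triple \<Rightarrow> bool" where
  "quadratic_rate s z \<longleftrightarrow>
     (\<exists>K. \<forall>j. triple_norm (s (Suc j) - z) \<le> K * (triple_norm (s j - z))\<^sup>2)"

end

theory Submission
  imports Defs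
begin

text \<open>The Jacobian at a triple \<open>(u, v, w)\<close> annihilates \<open>(u, - v, - w)\<close>, the tangent of the curve
  \<open>(t u, v / t, w / t)\<close> of triples with the same products. At an exact zero coprimality of the cofactors
  leaves no further kernel, so the rank is \<open>r\<close> there; being coercive on the orthogonal complement of the
  tangent is an open condition, hence the rank is \<open>r\<close> nearby as well. Consequently the rank-\<open>r\<close>
  projection does nothing near the zero, and the iteration is a Gauss-Newton iteration: each step solves the
  normal equations and is orthogonal to the tangent. Since the map is quadratic, consecutive
  steps satisfy \<open>\<bar>h'\<bar> \<le> \<sigma> \<mu> \<bar>h\<bar> (\<sigma> \<bar>f\<bar> + \<bar>h\<bar>)\<close>, a contraction when the residual \<open>f\<close> is small and
  quadratic when the residual vanishes in the limit. For the error bound the limit is compared with the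
  point of the curve through the zero for which the difference is orthogonal to the
  tangent at the limit; its parameter \<open>t\<close> is a root of a quadratic polynomial.\<close>

section \<open>Inner products\<close>

text \<open>The kernel at a zero is a complex line, so orthogonality to the tangent has to be tested
  with a complex-valued form, whereas the least-squares argument needs only its real part; hence
  there are two inner products. The distance from the limit to the given zero need not be of the
  order of the data error, because the initial iterate influences the position along the curve; only
  the part of the error orthogonal to a tangent is controlled. The tangent at the limit is the right
  one, since both stationarity and coercivity are available there. The constants arise as follows:
  at the zero the coercivity constant is the norm \<kappa> of the pseudoinverse; passing to nearby
  triples costs a factor 3/2, and absorbing the quadratic remainder a factor 4/3. The error bound is
  therefore 2 \<kappa> times the data error, with no higher-order term left over.\<close>

text \<open>The class \<^class>\<open>real_inner\<close> is out of reach for \<^typ>\<open>complex poly\<close>: its superclass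
  \<^class>\<open>sgn\<close> already has an instance for polynomials over linearly ordered domains only.\<close>

locale inner_product =
  fixes ip :: "'a::real_vector \<Rightarrow> 'a \<Rightarrow> real"
  assumes ip_commute: "ip x y = ip y x"
    and ip_add_left: "ip (x + y) z = ip x z + ip y z"
    and ip_scaleR_left: "ip (a *\<^sub>R x) y = a * ip x y"
    and ip_ge_0: "0 \<le> ip x x"
    and ip_eq_0: "ip x x = 0 \<Longrightarrow> x = 0"
begin

lemma ip_add_right: "ip z (x + y) = ip z x + ip z y"
  by (metis ip_add_left ip_commute)

lemma ip_scaleR_right: "ip y (a *\<^sub>R x) = a * ip y x"
  by (metis ip_scaleR_left ip_commute)

lemma ip_minus_left: "ip (- x) y = - ip x y"
  using ip_scaleR_left[of "-1"] by simp

lemma ip_minus_right: "ip y (- x) = - ip y x"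
  using ip_scaleR_right[of _ "-1"] by simp

lemma ip_diff_left: "ip (x - y) z = ip x z - ip y z"
  using ip_add_left[of x "- y"] by (simp add: ip_minus_left)

lemma ip_diff_right: "ip z (x - y) = ip z x - ip z y"
  using ip_add_right[of _ x "- y"] by (simp add: ip_minus_right)

lemma ip_zero_left [simp]: "ip 0 x = 0"
  using ip_scaleR_left[of 0] by simp

lemma ip_zero_right [simp]: "ip x 0 = 0"
  using ip_scaleR_right[of _ 0] by simp

lemmas ip_simps = ip_add_left ip_add_right ip_scaleR_left ip_scaleR_right
  ip_minus_left ip_minus_right ip_diff_left ip_diff_right

definition nrm :: "'a \<Rightarrow> real" where
  "nrm x = sqrt (ip x x)"

lemma nrm_ge_0 [simp]: "0 \<le> nrm x"
  by (simp add: nrm_def ip_ge_0)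

lemma nrm_power2: "(nrm x)\<^sup>2 = ip x x"
  by (simp add: nrm_def ip_ge_0)

lemma nrm_zero [simp]: "nrm 0 = 0"
  by (simp add: nrm_def)

lemma nrm_eq_0 [simp]: "nrm x = 0 \<longleftrightarrow> x = 0"
  using ip_eq_0 nrm_power2[of x] by auto

lemma nrm_pos [simp]: "0 < nrm x \<longleftrightarrow> x \<noteq> 0"
  by (metis nrm_eq_0 nrm_ge_0 less_le)

lemma nrm_minus [simp]: "nrm (- x) = nrm x"
  by (simp add: nrm_def ip_minus_left ip_minus_right)

lemma nrm_minus_commute: "nrm (x - y) = nrm (y - x)"
  using nrm_minus[of "x - y"] by simp

lemma ip_le_nrm: "\<bar>ip x y\<bar> \<le> nrm x * nrm y"
proof (cases "y = 0")
  case False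
  then have y: "0 < ip y y"
    using nrm_power2[of y] nrm_pos[of y] by (metis zero_less_power)
  define a where "a = ip x y / ip y y"
  have "0 \<le> ip (x - a *\<^sub>R y) (x - a *\<^sub>R y)"
    by (rule ip_ge_0)
  also have "\<dots> = ip x x - 2 * a * ip x y + a * a * ip y y"
    by (simp add: ip_simps ip_commute[of y x] algebra_simps)
  also have "\<dots> = ip x x - (ip x y)\<^sup>2 / ip y y"
    using y by (simp add: a_def power2_eq_square field_simps)
  finally have "(ip x y)\<^sup>2 \<le> ip x x * ip y y"
    using y by (simp add: field_simps)
  then show ?thesis
    by (metis nrm_power2 power_mult_distrib nrm_ge_0 mult_nonneg_nonneg real_sqrt_abs
        real_sqrt_le_iff abs_of_nonneg)
qed simp

lemma nrm_triangle: "nrm (x + y) \<le> nrm x + nrm y"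
proof (rule power2_le_imp_le)
  have "(nrm (x + y))\<^sup>2 = (nrm x)\<^sup>2 + 2 * ip x y + (nrm y)\<^sup>2"
    by (simp add: nrm_power2 ip_simps ip_commute[of y x])
  also have "\<dots> \<le> (nrm x + nrm y)\<^sup>2"
    using ip_le_nrm[of x y] by (simp add: power2_sum)
  finally show "(nrm (x + y))\<^sup>2 \<le> (nrm x + nrm y)\<^sup>2" .
qed simp

lemma nrm_triangle_diff: "nrm (x - z) \<le> nrm (x - y) + nrm (y - z)"
  using nrm_triangle[of "x - y" "y - z"] by simp

lemma nrm_diff_le: "nrm (x - y) \<le> nrm x + nrm y"
  using nrm_triangle[of x "- y"] by simp

lemma nrm_sum_le: "nrm (sum f A) \<le> (\<Sum>i\<in>A. nrm (f i))"
  by (induction A rule: infinite_finite_induct) (auto intro: order_trans[OF nrm_triangle])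

text \<open>One factor of the norm cancels. Estimates obtained by testing an identity against the
  very vector to be bounded have this form; the zero vector is dealt with here once.\<close>

lemma nrm_le_of_ip_le:
  assumes "ip x x \<le> c * nrm x" "0 \<le> c"
  shows "nrm x \<le> c"
proof (cases "x = 0")
  case False
  with assms show ?thesis
    by (metis nrm_power2 power2_eq_square mult_le_cancel_right_pos nrm_pos)
qed (use assms in simp)

text \<open>Completeness is relative to a set because the space of all polynomials is not complete
  in the coefficient norm; only the subspaces of bounded degree are.\<close>

definition complete_on :: "'a set \<Rightarrow> bool" where
  "complete_on V \<longleftrightarrow> (\<forall>s. (\<forall>j. s j \<in> V) \<longrightarrow>
     (\<forall>e>0. \<exists>M. \<forall>a\<ge>M. \<forall>b\<ge>M. nrm (s a - s b) < e) \<longrightarrow>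
     (\<exists>l\<in>V. (\<lambda>j. nrm (s j - l)) \<longlonglongrightarrow> 0))"

end

lemma inner_product_prod:
  assumes "inner_product ip1" "inner_product ip2"
  shows "inner_product (\<lambda>x y. ip1 (fst x) (fst y) + ip2 (snd x) (snd y))"
proof -
  interpret A: inner_product ip1 by fact
  interpret B: inner_product ip2 by fact
  show ?thesis
  proof
    show "x = 0" if "ip1 (fst x) (fst x) + ip2 (snd x) (snd x) = 0" for x
      using that A.ip_ge_0[of "fst x"] B.ip_ge_0[of "snd x"] A.ip_eq_0[of "fst x"] B.ip_eq_0[of "snd x"]
      by (auto simp: prod_eq_iff)
  qed (auto simp: A.ip_commute B.ip_commute A.ip_simps B.ip_simps algebra_simps
      intro: add_nonneg_nonneg A.ip_ge_0 B.ip_ge_0)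
qed
section \<open>The Gauss-Newton iteration for a quadratic map\<close>

text \<open>\<open>B\<close> is the differential of the quadratic map \<open>F\<close>. The
  expansion \<open>F_add\<close> is exact: its second-order term is the value \<open>F h\<close>
  itself, so the single constant \<open>\<mu>\<close> controls both the variation of the
  differential and the remainder.\<close>

locale gauss_newton = X: inner_product ipX + Y: inner_product ipY
  for ipX :: "'a::real_vector \<Rightarrow> 'a \<Rightarrow> real" and ipY :: "'b::real_vector \<Rightarrow> 'b \<Rightarrow> real" +
  fixes V :: "'a set" and B :: "'a \<Rightarrow> 'a \<Rightarrow> 'b" and F :: "'a \<Rightarrow> 'b" and \<mu> :: real
  assumes diff_mem: "x \<in> V \<Longrightarrow> y \<in> V \<Longrightarrow> x - y \<in> V"
    and complete: "X.complete_on V"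
    and F_add: "x \<in> V \<Longrightarrow> h \<in> V \<Longrightarrow> F (x + h) = F x + B x h + F h"
    and B_diff_left: "B (x - y) h = B x h - B y h"
    and \<mu>_pos: "0 < \<mu>"
    and B_bound: "x \<in> V \<Longrightarrow> h \<in> V \<Longrightarrow> Y.nrm (B x h) \<le> \<mu> * (X.nrm x * X.nrm h)"
    and F_bound: "h \<in> V \<Longrightarrow> Y.nrm (F h) \<le> \<mu> * (X.nrm h)\<^sup>2"
begin

lemma minus_mem: "x \<in> V \<Longrightarrow> - x \<in> V"
  using diff_mem[of "x - x" x] diff_mem[of x x] by simp

lemma add_mem: "x \<in> V \<Longrightarrow> y \<in> V \<Longrightarrow> x + y \<in> V"
  using diff_mem[of x "- y"] minus_mem[of y] by simp

lemma F_diff_bound: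
  assumes "x \<in> V" "y \<in> V"
  shows "Y.nrm (F y - F x) \<le> \<mu> * (X.nrm x + X.nrm (y - x)) * X.nrm (y - x)"
proof -
  have "F y - F x = B x (y - x) + F (y - x)"
    using F_add[of x "y - x"] assms diff_mem by simp
  also have "Y.nrm \<dots> \<le> \<mu> * (X.nrm x * X.nrm (y - x)) + \<mu> * (X.nrm (y - x))\<^sup>2"
    by (rule order_trans[OF Y.nrm_triangle add_mono])
       (use B_bound F_bound assms diff_mem in auto)
  finally show ?thesis
    by (simp add: algebra_simps power2_eq_square)
qed

text \<open>A step is characterised by the normal equations and a length bound rather than by a
  formula. This keeps pseudoinverses out of the convergence proof: orthogonality to the kernel
  enters only through the last conjunct.\<close>

definition gauss_newton_step :: "'b \<Rightarrow> real \<Rightarrow> 'a \<Rightarrow> 'a \<Rightarrow> bool" where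
  "gauss_newton_step d \<sigma> y h \<longleftrightarrow> h \<in> V \<and>
     (\<forall>k\<in>V. ipY (F y - d + B y h) (B y k) = 0) \<and> X.nrm h \<le> \<sigma> * Y.nrm (B y h)"

text \<open>By the normal equations \<open>- B y h\<close> is the orthogonal projection of the
  residual onto the range of \<open>B y\<close>, and projections do not increase the norm.\<close>

lemma step_image_le:
  assumes "gauss_newton_step d \<sigma> y h"
  shows "Y.nrm (B y h) \<le> Y.nrm (F y - d)"
proof (rule Y.nrm_le_of_ip_le)
  have "ipY (F y - d + B y h) (B y h) = 0"
    using assms by (simp add: gauss_newton_step_def)
  then have "ipY (B y h) (B y h) = - ipY (F y - d) (B y h)"
    unfolding Y.ip_add_left by linarith
  also have "\<dots> \<le> Y.nrm (F y - d) * Y.nrm (B y h)"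
    using Y.ip_le_nrm[of "F y - d" "B y h"] by linarith
  finally show "ipY (B y h) (B y h) \<le> Y.nrm (F y - d) * Y.nrm (B y h)" .
qed simp

lemma step_le:
  assumes "gauss_newton_step d \<sigma> y h" "0 \<le> \<sigma>"
  shows "X.nrm h \<le> \<sigma> * Y.nrm (F y - d)"
  using step_image_le[OF assms(1)] assms
  by (meson gauss_newton_step_def mult_left_mono order_trans)

text \<open>The residual \<open>F y - d + B y h\<close> of the linearised problem is orthogonal to the range of
  \<open>B y\<close>, hence almost orthogonal to that of \<open>B (y + h)\<close>: it enters the next step only with a
  factor \<open>h\<close>.\<close>

lemma next_step_le:
  assumes y: "y \<in> V" and h: "gauss_newton_step d \<sigma> y h"
    and h': "gauss_newton_step d \<sigma> (y + h) h'" and \<sigma>: "0 \<le> \<sigma>"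
  shows "X.nrm h' \<le> \<sigma> * \<mu> * X.nrm h * (\<sigma> * Y.nrm (F y - d) + X.nrm h)"
proof -
  define r where "r = F y - d + B y h"
  define b where "b = B (y + h) h'"
  have V: "h \<in> V" "h' \<in> V"
    using h h' by (auto simp: gauss_newton_step_def)
  \<comment> \<open>Pythagoras: the old residual is the difference of \<open>r\<close> and
    \<open>B y h\<close>, which are orthogonal.\<close>
  have "(Y.nrm r)\<^sup>2 \<le> (Y.nrm (F y - d))\<^sup>2"
  proof -
    have "ipY r (B y h) = 0"
      using h V by (simp add: gauss_newton_step_def r_def)
    moreover have eq: "F y - d = r - B y h"
      by (simp add: r_def)
    have "ipY (F y - d) (F y - d) = ipY r r - 2 * ipY r (B y h) + ipY (B y h) (B y h)"
      unfolding eq Y.ip_diff_left Y.ip_diff_right using Y.ip_commute[of "B y h" r] by simp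
    ultimately show ?thesis
      using Y.ip_ge_0[of "B y h"] unfolding Y.nrm_power2 by linarith
  qed
  then have r: "Y.nrm r \<le> Y.nrm (F y - d)"
    by (rule power2_le_imp_le) simp
  have "ipY r b = ipY r (B h h')"
  proof -
    have "B h h' = b - B y h'"
      using B_diff_left[of "y + h" y h'] by (simp add: b_def)
    moreover have "ipY r (B y h') = 0"
      using h V by (simp add: gauss_newton_step_def r_def)
    ultimately show ?thesis
      by (simp add: Y.ip_simps)
  qed
  \<comment> \<open>The linear term is already part of \<open>r\<close>, so the residual at the new
    point adds only the quadratic remainder.\<close>
  moreover have "F (y + h) - d = r + F h"
    using F_add[OF y V(1)] by (simp add: r_def)
  then have "ipY (r + F h + b) b = 0"
    using h' V by (simp add: gauss_newton_step_def b_def)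
  ultimately have "ipY b b = - ipY r (B h h') - ipY (F h) b"
    by (simp add: Y.ip_simps)
  also have "\<dots> \<le> Y.nrm r * Y.nrm (B h h') + Y.nrm (F h) * Y.nrm b"
    using Y.ip_le_nrm[of r "B h h'"] Y.ip_le_nrm[of "F h" b] by linarith
  also have "\<dots> \<le> Y.nrm (F y - d) * (\<mu> * (X.nrm h * (\<sigma> * Y.nrm b))) + (\<mu> * (X.nrm h)\<^sup>2) * Y.nrm b"
  proof (intro add_mono mult_mono r)
    have "X.nrm h' \<le> \<sigma> * Y.nrm b"
      using h' by (simp add: gauss_newton_step_def b_def)
    then show "Y.nrm (B h h') \<le> \<mu> * (X.nrm h * (\<sigma> * Y.nrm b))"
      using B_bound[OF V] \<mu>_pos by (meson X.nrm_ge_0 less_imp_le mult_left_mono order_trans)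
  qed (use F_bound V \<mu>_pos in auto)
  also have "\<dots> = \<mu> * X.nrm h * (\<sigma> * Y.nrm (F y - d) + X.nrm h) * Y.nrm b"
    by (simp add: algebra_simps power2_eq_square)
  finally have "Y.nrm b \<le> \<mu> * X.nrm h * (\<sigma> * Y.nrm (F y - d) + X.nrm h)"
    by (rule Y.nrm_le_of_ip_le) (use \<mu>_pos \<sigma> in simp)
  then have "\<sigma> * Y.nrm b \<le> \<sigma> * (\<mu> * X.nrm h * (\<sigma> * Y.nrm (F y - d) + X.nrm h))"
    using \<sigma> by (rule mult_left_mono)
  moreover have "X.nrm h' \<le> \<sigma> * Y.nrm b"
    using h' by (simp add: gauss_newton_step_def b_def)
  ultimately show ?thesis
    by (simp add: mult.assoc)
qed

end

text \<open>All requirements refer to a ball around \<open>z0\<close>. The residual bound makes the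
  contraction factor \<open>2 * \<sigma>\<^sup>2 * \<mu> * Y.nrm (F x - d)\<close> at most 1/2.
  Twice the first step then bounds the sum of all step lengths, and the last assumption keeps that
  total inside the ball.\<close>

locale gauss_newton_iteration = gauss_newton +
  fixes d :: 'b and z0 :: 'a and \<rho> \<sigma> :: real and H :: "'a \<Rightarrow> 'a" and y :: "nat \<Rightarrow> 'a"
  assumes \<sigma>_pos: "0 < \<sigma>"
    and step: "x \<in> V \<Longrightarrow> X.nrm (x - z0) < \<rho> \<Longrightarrow> gauss_newton_step d \<sigma> x (H x)"
    and residual: "x \<in> V \<Longrightarrow> X.nrm (x - z0) < \<rho> \<Longrightarrow> Y.nrm (F x - d) \<le> 1 / (4 * \<sigma>\<^sup>2 * \<mu>)"
    and y_Suc: "y (Suc j) = y j + H (y j)"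
    and y_0: "y 0 \<in> V" "X.nrm (y 0 - z0) + 2 * X.nrm (H (y 0)) < \<rho>"
begin

text \<open>In \<open>next_step_le\<close> the step length is itself at most \<open>\<sigma>\<close>
  times the residual, which merges the two summands. The first form gives convergence; the second
  keeps the residual as a factor, which yields the quadratic rate when the residual tends to
  zero.\<close>

lemma contraction:
  assumes "x \<in> V" "X.nrm (x - z0) < \<rho>" "X.nrm (x + H x - z0) < \<rho>"
  shows "X.nrm (H (x + H x)) \<le> X.nrm (H x) / 2"
    and "X.nrm (H (x + H x)) \<le> 2 * \<sigma>\<^sup>2 * \<mu> * Y.nrm (F x - d) * X.nrm (H x)"
proof -
  have s: "gauss_newton_step d \<sigma> x (H x)"
    using step assms by blast
  then have "x + H x \<in> V"
    using assms add_mem by (simp add: gauss_newton_step_def)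
  then have s': "gauss_newton_step d \<sigma> (x + H x) (H (x + H x))"
    using step assms by blast
  have "X.nrm (H (x + H x)) \<le> \<sigma> * \<mu> * X.nrm (H x) * (\<sigma> * Y.nrm (F x - d) + X.nrm (H x))"
    using next_step_le[OF assms(1) s s'] \<sigma>_pos by simp
  also have "\<dots> \<le> \<sigma> * \<mu> * X.nrm (H x) * (\<sigma> * Y.nrm (F x - d) + \<sigma> * Y.nrm (F x - d))"
    using step_le[OF s] \<sigma>_pos \<mu>_pos by (intro mult_left_mono add_left_mono) auto
  finally show le: "X.nrm (H (x + H x)) \<le> 2 * \<sigma>\<^sup>2 * \<mu> * Y.nrm (F x - d) * X.nrm (H x)"
    by (simp add: algebra_simps power2_eq_square)
  have "2 * \<sigma>\<^sup>2 * \<mu> * Y.nrm (F x - d) \<le> 2 * \<sigma>\<^sup>2 * \<mu> * (1 / (4 * \<sigma>\<^sup>2 * \<mu>))"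
    using residual[OF assms(1,2)] \<sigma>_pos \<mu>_pos by (intro mult_left_mono) auto
  also have "\<dots> = 1 / 2"
    using \<sigma>_pos \<mu>_pos by (simp add: field_simps)
  finally have "2 * \<sigma>\<^sup>2 * \<mu> * Y.nrm (F x - d) * X.nrm (H x) \<le> 1 / 2 * X.nrm (H x)"
    by (rule mult_right_mono) simp
  with le show "X.nrm (H (x + H x)) \<le> X.nrm (H x) / 2"
    by linarith
qed

text \<open>The quantity \<open>X.nrm (y j - z0) + 2 * X.nrm (H (y j))\<close> never increases: a
  step adds at most its length to the first summand, and halving the step removes at least as much
  from the second.\<close>

lemma iterates:
  "y j \<in> V" "X.nrm (y j - z0) + 2 * X.nrm (H (y j)) \<le> X.nrm (y 0 - z0) + 2 * X.nrm (H (y 0))"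
proof (induction j)
  case (Suc j)
  have lt: "X.nrm (y j - z0) < \<rho>" and lt': "X.nrm (y j - z0) + 2 * X.nrm (H (y j)) < \<rho>"
    using Suc y_0 X.nrm_ge_0[of "H (y j)"] by linarith+
  have le: "X.nrm (y (Suc j) - z0) \<le> X.nrm (y j - z0) + X.nrm (H (y j))"
    using X.nrm_triangle[of "y j - z0" "H (y j)"] by (simp add: y_Suc algebra_simps)
  then have "X.nrm (y j + H (y j) - z0) < \<rho>"
    using lt' X.nrm_ge_0[of "H (y j)"] unfolding y_Suc by linarith
  from contraction(1)[OF Suc(1) lt this] le Suc(2)
  show "X.nrm (y (Suc j) - z0) + 2 * X.nrm (H (y (Suc j))) \<le> X.nrm (y 0 - z0) + 2 * X.nrm (H (y 0))"
    by (simp add: y_Suc)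
  have "H (y j) \<in> V"
    using step[OF Suc(1) lt] by (simp add: gauss_newton_step_def)
  with Suc(1) show "y (Suc j) \<in> V"
    by (simp add: y_Suc add_mem)
qed (use y_0 in auto)

lemma iterates_near: "X.nrm (y j - z0) < \<rho>"
  using iterates(2)[of j] y_0 X.nrm_ge_0[of "H (y j)"] by linarith

lemma step_iterate: "gauss_newton_step d \<sigma> (y j) (H (y j))"
  using step iterates iterates_near by blast

lemma step_Suc_le:
  "X.nrm (H (y (Suc j))) \<le> X.nrm (H (y j)) / 2"
  "X.nrm (H (y (Suc j))) \<le> 2 * \<sigma>\<^sup>2 * \<mu> * Y.nrm (F (y j) - d) * X.nrm (H (y j))"
  using contraction[OF iterates(1) iterates_near, of j] iterates_near[of "Suc j"]
  by (simp_all add: y_Suc)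

lemma step_geometric: "X.nrm (H (y j)) \<le> X.nrm (H (y 0)) * (1 / 2) ^ j"
  by (induction j) (use step_Suc_le(1) in \<open>auto intro: order_trans\<close>)

lemma steps_vanish: "(\<lambda>j. X.nrm (H (y j))) \<longlonglongrightarrow> 0"
proof (rule real_tendsto_sandwich[OF _ _ tendsto_const])
  show "(\<lambda>j. X.nrm (H (y 0)) * (1 / 2) ^ j) \<longlonglongrightarrow> 0"
    using tendsto_mult_left[OF LIMSEQ_realpow_zero[of "1 / 2"]] by simp
qed (use step_geometric in auto)

text \<open>The same balance as in \<open>iterates\<close>, with the moving point \<open>y j\<close>
  as centre; it provides the Cauchy property and the distance to the limit.\<close>

lemma iterate_dist: "X.nrm (y (j + i) - y j) + 2 * X.nrm (H (y (j + i))) \<le> 2 * X.nrm (H (y j))"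
proof (induction i)
  case (Suc i)
  have "X.nrm (y (j + Suc i) - y j) \<le> X.nrm (y (j + i) - y j) + X.nrm (H (y (j + i)))"
    using X.nrm_triangle[of "y (j + i) - y j" "H (y (j + i))"] by (simp add: y_Suc algebra_simps)
  with Suc step_Suc_le(1)[of "j + i"] show ?case
    by simp
qed simp

lemma converges:
  obtains z where "z \<in> V" "(\<lambda>j. X.nrm (y j - z)) \<longlonglongrightarrow> 0"
proof -
  have "\<exists>M. \<forall>a\<ge>M. \<forall>b\<ge>M. X.nrm (y a - y b) < e" if "e > 0" for e
  proof -
    obtain M where M: "X.nrm (H (y M)) < e / 4"
      using order_tendstoD(2)[OF steps_vanish, of "e / 4"] \<open>e > 0\<close>
      by (auto simp: eventually_sequentially)
    have near: "X.nrm (y a - y M) < e / 2" if "a \<ge> M" for a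
    proof -
      have "X.nrm (y a - y M) + 2 * X.nrm (H (y a)) \<le> 2 * X.nrm (H (y M))"
        using iterate_dist[of M "a - M"] that by simp
      then show ?thesis
        using M X.nrm_ge_0[of "H (y a)"] by linarith
    qed
    have "X.nrm (y a - y b) < e" if "a \<ge> M" "b \<ge> M" for a b
      using X.nrm_triangle_diff[of "y a" "y b" "y M"] near[OF that(1)] near[OF that(2)]
        X.nrm_minus_commute[of "y M" "y b"] by linarith
    then show ?thesis by blast
  qed
  then show ?thesis
    using complete iterates(1) that unfolding X.complete_on_def by blast
qed

section \<open>Properties of the limit\<close>

context
  fixes z :: 'a
  assumes z: "z \<in> V" and lim: "(\<lambda>j. X.nrm (y j - z)) \<longlonglongrightarrow> 0"
begin

lemma limit_dist: "X.nrm (y j - z) \<le> 2 * X.nrm (H (y j))"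
proof (rule field_le_epsilon)
  fix e :: real assume "e > 0"
  obtain M where M: "\<And>i. i \<ge> M \<Longrightarrow> X.nrm (y i - z) < e"
    using order_tendstoD(2)[OF lim \<open>e > 0\<close>] by (auto simp: eventually_sequentially)
  have "X.nrm (y (j + M) - z) < e"
    using M by simp
  then show "X.nrm (y j - z) \<le> 2 * X.nrm (H (y j)) + e"
    using X.nrm_triangle_diff[of "y j" z "y (j + M)"] iterate_dist[of j M]
      X.nrm_minus_commute[of "y j" "y (j + M)"] X.nrm_ge_0[of "H (y (j + M))"] by linarith
qed

lemma limit_near: "X.nrm (z - z0) \<le> X.nrm (y 0 - z0) + 2 * X.nrm (H (y 0))"
  using X.nrm_triangle_diff[of z z0 "y 0"] limit_dist[of 0] X.nrm_minus_commute[of z "y 0"]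
  by linarith

text \<open>The normal equation at \<open>y j\<close> equates \<open>\<phi> (y j)\<close> with a
  product containing the step, which vanishes in the limit. Continuity of \<open>F\<close> and
  \<open>B\<close> is replaced by the explicit bound \<open>?R\<close>, a polynomial in the distance
  \<open>\<epsilon> j\<close> and the step length.\<close>

lemma limit_stationary:
  assumes k: "k \<in> V"
  shows "ipY (F z - d) (B z k) = 0"
proof -
  define \<phi> where "\<phi> x = ipY (F x - d) (B x k)" for x
  define \<epsilon> where "\<epsilon> j = X.nrm (y j - z)" for j
  define c where "c = 1 / (4 * \<sigma>\<^sup>2 * \<mu>)"
  have "\<bar>\<phi> z\<bar> \<le> (\<mu> * (X.nrm z + \<epsilon> j) * \<epsilon> j) * (\<mu> * (X.nrm z * X.nrm k))
      + c * (\<mu> * (\<epsilon> j * X.nrm k)) + (\<mu> * ((X.nrm z + \<epsilon> j) * X.nrm (H (y j)))) * (\<mu> * ((X.nrm z + \<epsilon> j) * X.nrm k))"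
    (is "_ \<le> ?R j") for j
  proof -
    have s: "gauss_newton_step d \<sigma> (y j) (H (y j))"
      by (rule step_iterate)
    have H: "H (y j) \<in> V"
      using s by (simp add: gauss_newton_step_def)
    have yz: "y j - z \<in> V" "y j \<in> V"
      using iterates z diff_mem by blast+
    have ny: "X.nrm (y j) \<le> X.nrm z + \<epsilon> j"
      using X.nrm_triangle[of z "y j - z"] by (simp add: \<epsilon>_def)
    have "\<phi> (y j) = - ipY (B (y j) (H (y j))) (B (y j) k)"
    proof -
      have "ipY (F (y j) - d + B (y j) (H (y j))) (B (y j) k) = 0"
        using s k by (simp add: gauss_newton_step_def)
      then show ?thesis
        unfolding Y.ip_add_left \<phi>_def by linarith
    qed
    \<comment> \<open>The two arguments of the inner product are moved from \<open>y j\<close> to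
      \<open>z\<close> one at a time.\<close>
    moreover have "\<phi> (y j) - \<phi> z = ipY (F (y j) - F z) (B z k) + ipY (F (y j) - d) (B (y j - z) k)"
      by (simp add: \<phi>_def B_diff_left Y.ip_simps)
    ultimately have "\<bar>\<phi> z\<bar> \<le> \<bar>ipY (F (y j) - F z) (B z k)\<bar> + \<bar>ipY (F (y j) - d) (B (y j - z) k)\<bar>
        + \<bar>ipY (B (y j) (H (y j))) (B (y j) k)\<bar>"
      by linarith
    also have "\<dots> \<le> Y.nrm (F (y j) - F z) * Y.nrm (B z k) + Y.nrm (F (y j) - d) * Y.nrm (B (y j - z) k)
        + Y.nrm (B (y j) (H (y j))) * Y.nrm (B (y j) k)"
      by (intro add_mono Y.ip_le_nrm)
    also have "\<dots> \<le> ?R j"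
    proof (intro add_mono mult_mono)
      show "Y.nrm (F (y j) - F z) \<le> \<mu> * (X.nrm z + \<epsilon> j) * \<epsilon> j"
        using F_diff_bound[OF z yz(2)] by (simp add: \<epsilon>_def)
      show "Y.nrm (F (y j) - d) \<le> c"
        using residual[OF iterates(1) iterates_near] by (simp add: c_def)
      show "Y.nrm (B (y j) (H (y j))) \<le> \<mu> * ((X.nrm z + \<epsilon> j) * X.nrm (H (y j)))"
        using B_bound[OF yz(2) H] ny \<mu>_pos
        by (meson X.nrm_ge_0 less_imp_le mult_left_mono mult_right_mono order_trans)
      show "Y.nrm (B (y j) k) \<le> \<mu> * ((X.nrm z + \<epsilon> j) * X.nrm k)"
        using B_bound[OF yz(2) k] ny \<mu>_pos
        by (meson X.nrm_ge_0 less_imp_le mult_left_mono mult_right_mono order_trans)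
    qed (use B_bound z k yz \<mu>_pos in \<open>auto simp: \<epsilon>_def c_def\<close>)
    finally show ?thesis .
  qed
  moreover have "?R \<longlonglongrightarrow> 0"
  proof -
    have "\<epsilon> \<longlonglongrightarrow> 0"
      using lim by (simp add: \<epsilon>_def[abs_def])
    then have "?R \<longlonglongrightarrow> (\<mu> * (X.nrm z + 0) * 0) * (\<mu> * (X.nrm z * X.nrm k))
      + c * (\<mu> * (0 * X.nrm k)) + (\<mu> * ((X.nrm z + 0) * 0)) * (\<mu> * ((X.nrm z + 0) * X.nrm k))"
      by (intro tendsto_intros steps_vanish)
    then show ?thesis by simp
  qed
  ultimately have "\<bar>\<phi> z\<bar> \<le> 0"
    by (intro LIMSEQ_le_const) auto
  then show ?thesis
    by (simp add: \<phi>_def)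
qed

text \<open>The next error is at most twice the next step, which is bounded by residual times
  current step. Since the residual vanishes at \<open>z\<close>, both factors are at most a constant
  times the current error.\<close>

lemma quadratic_convergence:
  assumes "F z = d"
  shows "\<exists>K. \<forall>j. X.nrm (y (Suc j) - z) \<le> K * (X.nrm (y j - z))\<^sup>2"
proof -
  \<comment> \<open>A Lipschitz constant that serves for all iterates, whose distance from
    \<open>z\<close> is at most \<open>X.nrm (z - z0) + \<rho>\<close>.\<close>
  define C where "C = \<mu> * (X.nrm z + X.nrm (z - z0) + \<rho>)"
  have "X.nrm (y (Suc j) - z) \<le> 4 * \<sigma> ^ 3 * \<mu> * C\<^sup>2 * (X.nrm (y j - z))\<^sup>2" for j
  proof -
    define e where "e = X.nrm (y j - z)"
    have "0 < \<rho>"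
      using iterates_near[of 0] X.nrm_ge_0[of "y 0 - z0"] by linarith
    then have C: "0 \<le> C"
      using \<mu>_pos by (auto simp: C_def intro!: mult_nonneg_nonneg add_nonneg_nonneg)
    have "e \<le> X.nrm (z - z0) + \<rho>"
      using X.nrm_triangle_diff[of "y j" z z0] iterates_near[of j] X.nrm_minus_commute[of z z0]
      by (simp add: e_def)
    then have "\<mu> * (X.nrm z + e) * e \<le> C * e"
      using \<mu>_pos by (auto simp: C_def e_def intro!: mult_right_mono)
    then have res: "Y.nrm (F (y j) - d) \<le> C * e"
      using F_diff_bound[OF z iterates(1)[of j]] assms by (simp add: e_def)
    then have "\<sigma> * Y.nrm (F (y j) - d) \<le> \<sigma> * (C * e)"
      using \<sigma>_pos by simp
    then have H: "X.nrm (H (y j)) \<le> \<sigma> * (C * e)"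
      using step_le[OF step_iterate[of j]] \<sigma>_pos by linarith
    have "X.nrm (y (Suc j) - z) \<le> 2 * X.nrm (H (y (Suc j)))"
      by (rule limit_dist)
    also have "\<dots> \<le> 2 * (2 * \<sigma>\<^sup>2 * \<mu> * (Y.nrm (F (y j) - d) * X.nrm (H (y j))))"
      using step_Suc_le(2)[of j] by (simp only: mult.assoc)
    also have "\<dots> \<le> 2 * (2 * \<sigma>\<^sup>2 * \<mu> * ((C * e) * (\<sigma> * (C * e))))"
      using res H C \<sigma>_pos \<mu>_pos
      by (intro mult_left_mono mult_mono) (auto simp: e_def)
    finally show ?thesis
      by (simp add: e_def power2_eq_square power3_eq_cube mult_ac)
  qed
  then show ?thesis
    by blast
qed

end

end

section \<open>Distance of a stationary point from an exact solution\<close>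

context gauss_newton
begin

text \<open>Expanding at \<open>z\<close> writes the residual as \<open>B z h\<close> minus data
  error and remainder. Stationarity tested on \<open>h\<close> bounds \<open>B z h\<close> by these
  two, and coercivity turns this into a bound on \<open>h\<close>. By \<open>small\<close> the
  remainder costs at most a quarter of the norm of \<open>h\<close>; moving it to the left gives the
  factor 4/3.\<close>

lemma stationary_error:
  assumes z: "z \<in> V" "h \<in> V" and exact: "F (z - h) = p"
    and stat: "\<And>k. k \<in> V \<Longrightarrow> ipY (F z - d) (B z k) = 0"
    and coercive: "X.nrm h \<le> \<sigma> * Y.nrm (B z h)"
    and small: "\<sigma> * \<mu> * X.nrm h \<le> 1 / 4" and \<sigma>: "0 \<le> \<sigma>"
    and expand: "F (z - h) = F z - B z h + F h"
  shows "X.nrm h \<le> 4 / 3 * \<sigma> * Y.nrm (d - p)"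
proof -
  have "F z - d = B z h - (d - p + F h)"
    using exact expand by (simp add: algebra_simps)
  with stat[OF z(2)] have "ipY (B z h) (B z h) = ipY (d - p + F h) (B z h)"
    by (simp add: Y.ip_simps)
  also have "\<dots> \<le> Y.nrm (d - p + F h) * Y.nrm (B z h)"
    using Y.ip_le_nrm by (meson abs_le_D1)
  finally have "Y.nrm (B z h) \<le> Y.nrm (d - p + F h)"
    by (rule Y.nrm_le_of_ip_le) simp
  also have "\<dots> \<le> Y.nrm (d - p) + \<mu> * (X.nrm h)\<^sup>2"
    using Y.nrm_triangle[of "d - p" "F h"] F_bound[OF z(2)] by linarith
  finally have "\<sigma> * Y.nrm (B z h) \<le> \<sigma> * (Y.nrm (d - p) + \<mu> * (X.nrm h)\<^sup>2)"
    using \<sigma> by (rule mult_left_mono)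
  with coercive have "X.nrm h \<le> \<sigma> * Y.nrm (d - p) + (\<sigma> * \<mu> * X.nrm h) * X.nrm h"
    by (simp add: algebra_simps power2_eq_square)
  also have "\<dots> \<le> \<sigma> * Y.nrm (d - p) + 1 / 4 * X.nrm h"
    using small by (intro add_left_mono mult_right_mono) auto
  finally show ?thesis by simp
qed

end

section \<open>Triples of polynomials as an inner product space\<close>

text \<open>The abstract iteration lives on real vector spaces; pairs and triples of polynomials
  inherit the structure through products.\<close>

instantiation poly :: (real_vector) real_vector
begin

definition scaleR_poly :: "real \<Rightarrow> 'a poly \<Rightarrow> 'a poly" where
  "scaleR_poly r f = map_poly ((*\<^sub>R) r) f"

lemma coeff_scaleR [simp]: "coeff (r *\<^sub>R f) i = r *\<^sub>R coeff f i"
  for f :: "'a poly"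
  by (simp add: scaleR_poly_def coeff_map_poly)

instance
  by standard (simp_all add: poly_eq_iff scaleR_add_right scaleR_add_left)

end

text \<open>Linear in the first argument and conjugate linear in the second. Coefficients of
  \<open>g\<close> above the degree of \<open>f\<close> would be multiplied by zero, so the sum may
  stop there.\<close>

definition poly_cinner :: "complex poly \<Rightarrow> complex poly \<Rightarrow> complex" where
  "poly_cinner f g = (\<Sum>i\<le>degree f. coeff f i * cnj (coeff g i))"

lemma poly_cinner_eq_sum:
  assumes "degree f \<le> l"
  shows "poly_cinner f g = (\<Sum>i\<le>l. coeff f i * cnj (coeff g i))"
  unfolding poly_cinner_def
  by (rule sum.mono_neutral_left) (use assms in \<open>auto simp: coeff_eq_0\<close>)

lemma poly_cinner_smult_left: "poly_cinner (Polynomial.smult a f) g = a * poly_cinner f g"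
  unfolding poly_cinner_eq_sum[OF degree_smult_le] poly_cinner_eq_sum[OF order_refl]
  by (simp add: sum_distrib_left mult.assoc)

lemma poly_cinner_smult_right: "poly_cinner f (Polynomial.smult a g) = cnj a * poly_cinner f g"
  by (simp add: poly_cinner_def sum_distrib_left mult_ac)

lemma poly_cinner_add_left: "poly_cinner (f + g) h = poly_cinner f h + poly_cinner g h"
proof -
  define l where "l = max (degree f) (degree g)"
  have "degree f \<le> l" "degree g \<le> l" "degree (f + g) \<le> l"
    by (auto simp: l_def degree_add_le)
  then show ?thesis
    by (simp add: poly_cinner_eq_sum[of _ l] sum.distrib algebra_simps)
qed

lemma poly_cinner_add_right: "poly_cinner f (g + h) = poly_cinner f g + poly_cinner f h"
  by (simp add: poly_cinner_def sum.distrib algebra_simps)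

lemma poly_cinner_minus_left: "poly_cinner (- f) g = - poly_cinner f g"
  using poly_cinner_smult_left[of "-1" f g] by simp

lemma poly_cinner_minus_right: "poly_cinner f (- g) = - poly_cinner f g"
  using poly_cinner_smult_right[of f "-1" g] by simp

lemma poly_cinner_commute: "poly_cinner g f = cnj (poly_cinner f g)"
proof -
  define l where "l = max (degree f) (degree g)"
  have "degree f \<le> l" "degree g \<le> l"
    by (auto simp: l_def)
  then show ?thesis
    by (simp add: poly_cinner_eq_sum[of _ l] mult.commute)
qed

lemma poly_norm_eq_sum:
  assumes "degree f \<le> l"
  shows "poly_norm f = sqrt (\<Sum>i\<le>l. (cmod (coeff f i))\<^sup>2)"
  unfolding poly_norm_def
  by (rule arg_cong[where f = sqrt], rule sum.mono_neutral_left)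
     (use assms in \<open>auto simp: coeff_eq_0\<close>)

lemma poly_cinner_self: "poly_cinner f f = of_real ((poly_norm f)\<^sup>2)"
proof -
  have "poly_cinner f f = of_real (\<Sum>i\<le>degree f. (cmod (coeff f i))\<^sup>2)"
    unfolding poly_cinner_def of_real_sum complex_norm_square ..
  also have "(\<Sum>i\<le>degree f. (cmod (coeff f i))\<^sup>2) = (poly_norm f)\<^sup>2"
    unfolding poly_norm_def by (rule real_sqrt_pow2[symmetric]) (simp add: sum_nonneg)
  finally show ?thesis .
qed

definition poly_inner :: "complex poly \<Rightarrow> complex poly \<Rightarrow> real" where
  "poly_inner f g = Re (poly_cinner f g)"

definition pair_inner :: "poly_pair \<Rightarrow> poly_pair \<Rightarrow> real" where
  "pair_inner x y = poly_inner (fst x) (fst y) + poly_inner (snd x) (snd y)"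

definition triple_inner :: "poly_triple \<Rightarrow> poly_triple \<Rightarrow> real" where
  "triple_inner x y = poly_inner (fst x) (fst y) + pair_inner (snd x) (snd y)"

lemma inner_product_poly: "inner_product poly_inner"
proof
  have scaleR: "r *\<^sub>R f = Polynomial.smult (complex_of_real r) f" for r f
    by (rule poly_eqI) (simp add: scaleR_conv_of_real)
  show "poly_inner (r *\<^sub>R f) g = r * poly_inner f g" for r f g
    by (simp add: scaleR poly_inner_def poly_cinner_smult_left)
  show "poly_inner f g = poly_inner g f" for f g
    unfolding poly_inner_def by (subst poly_cinner_commute) simp
  show "poly_inner (f + g) h = poly_inner f h + poly_inner g h" for f g h
    by (simp add: poly_inner_def poly_cinner_add_left)
  show "0 \<le> poly_inner f f" for f
    by (simp add: poly_inner_def poly_cinner_self)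
  show "f = 0" if "poly_inner f f = 0" for f
  proof (rule poly_eqI)
    fix i
    have "(\<Sum>i\<le>degree f. (cmod (coeff f i))\<^sup>2) = 0"
      using that by (simp add: poly_inner_def poly_cinner_self poly_norm_def sum_nonneg)
    then have "\<forall>i\<le>degree f. coeff f i = 0"
      by (subst (asm) sum_nonneg_eq_0_iff) auto
    then show "coeff f i = coeff 0 i"
      by (metis coeff_0 coeff_eq_0 not_less)
  qed
qed

lemma inner_product_pair: "inner_product pair_inner"
  unfolding pair_inner_def[abs_def] by (rule inner_product_prod[OF inner_product_poly inner_product_poly])

lemma inner_product_triple: "inner_product triple_inner"
  unfolding triple_inner_def[abs_def] by (rule inner_product_prod[OF inner_product_poly inner_product_pair])

interpretation poly: inner_product poly_inner
  rewrites "inner_product.nrm poly_inner = poly_norm"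
proof -
  show "inner_product poly_inner" by (rule inner_product_poly)
  show "inner_product.nrm poly_inner = poly_norm"
    by (rule ext) (simp add: inner_product.nrm_def[OF inner_product_poly] poly_inner_def
      poly_cinner_self poly_norm_def sum_nonneg)
qed

interpretation pair: inner_product pair_inner
  rewrites "inner_product.nrm pair_inner = pair_norm"
proof -
  show "inner_product pair_inner" by (rule inner_product_pair)
  show "inner_product.nrm pair_inner = pair_norm"
    by (rule ext) (auto simp: inner_product.nrm_def[OF inner_product_pair] pair_inner_def
      poly.nrm_power2)
qed

interpretation triple: inner_product triple_inner
  rewrites "inner_product.nrm triple_inner = triple_norm"
proof -
  show "inner_product triple_inner" by (rule inner_product_triple)
  show "inner_product.nrm triple_inner = triple_norm"
    by (rule ext) (auto simp: inner_product.nrm_def[OF inner_product_triple] triple_inner_def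
      pair_inner_def poly.nrm_power2 add.assoc)
qed

section \<open>Norm estimates for polynomials\<close>

lemma cmod_coeff_le: "cmod (coeff f i) \<le> poly_norm f"
proof (cases "i \<le> degree f")
  case True
  have "(cmod (coeff f i))\<^sup>2 \<le> (\<Sum>i\<le>degree f. (cmod (coeff f i))\<^sup>2)"
    by (rule member_le_sum) (use True in auto)
  then show ?thesis
    by (simp add: poly_norm_def real_le_rsqrt)
qed (simp add: coeff_eq_0)

lemma poly_norm_monom_mult: "poly_norm (monom a i * f) = cmod a * poly_norm f"
proof -
  have "degree (monom a i * f) \<le> i + degree f"
    by (metis degree_monom_le add_mono degree_mult_le order_refl order_trans)
  then have "poly_norm (monom a i * f) = sqrt (\<Sum>j\<le>i + degree f. (cmod (coeff (monom a i * f) j))\<^sup>2)"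
    by (rule poly_norm_eq_sum)
  also have "(\<Sum>j\<le>i + degree f. (cmod (coeff (monom a i * f) j))\<^sup>2)
      = (\<Sum>j\<in>{i..i + degree f}. (cmod (coeff (monom a i * f) j))\<^sup>2)"
    by (rule sum.mono_neutral_right) (auto simp: coeff_monom_mult)
  also have "\<dots> = (\<Sum>j\<le>degree f. (cmod a * cmod (coeff f j))\<^sup>2)"
    by (rule sum.reindex_bij_witness[of _ "\<lambda>j. j + i" "\<lambda>j. j - i"])
       (auto simp: coeff_monom_mult norm_mult)
  also have "\<dots> = (cmod a)\<^sup>2 * (\<Sum>j\<le>degree f. (cmod (coeff f j))\<^sup>2)"
    by (simp add: power_mult_distrib sum_distrib_left)
  finally show ?thesis
    by (simp add: real_sqrt_mult poly_norm_def)
qed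

lemma poly_norm_smult: "poly_norm (Polynomial.smult a f) = cmod a * poly_norm f"
  using poly_norm_monom_mult[of a 0 f] by (simp add: monom_0)

text \<open>Writing \<open>f\<close> as a sum of \<open>l + 1\<close> monomials splits the product
  into shifted copies of \<open>g\<close>, each scaled by a coefficient of modulus at most
  \<open>poly_norm f\<close>.\<close>

lemma poly_norm_mult_le:
  assumes "degree f \<le> l"
  shows "poly_norm (f * g) \<le> (l + 1) * (poly_norm f * poly_norm g)"
proof -
  have "f = (\<Sum>i\<le>l. monom (coeff f i) i)"
    using assms by (rule poly_as_sum_of_monoms'[symmetric])
  then have "poly_norm (f * g) = poly_norm (\<Sum>i\<le>l. monom (coeff f i) i * g)"
    by (metis sum_distrib_right)
  also have "\<dots> \<le> (\<Sum>i\<le>l. poly_norm (monom (coeff f i) i * g))"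
    by (rule poly.nrm_sum_le)
  also have "\<dots> \<le> (\<Sum>i\<le>l. poly_norm f * poly_norm g)"
    by (rule sum_mono) (simp add: poly_norm_monom_mult cmod_coeff_le mult_right_mono)
  finally show ?thesis
    by (simp add: algebra_simps)
qed

lemma poly_norm_le_triple_norm:
  "poly_norm (fst z) \<le> triple_norm z" "poly_norm (fst (snd z)) \<le> triple_norm z"
  "poly_norm (snd (snd z)) \<le> triple_norm z"
  by (cases z, auto intro!: real_le_rsqrt)+

lemma pair_norm_le: "pair_norm d \<le> poly_norm (fst d) + poly_norm (snd d)"
  by (cases d) (simp add: sqrt_sum_squares_le_sum)

lemma triple_norm_le: "triple_norm z \<le> poly_norm (fst z) + poly_norm (fst (snd z)) + poly_norm (snd (snd z))"
proof (cases z)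
  case (fields u v w)
  have "(poly_norm u)\<^sup>2 + (poly_norm v)\<^sup>2 + (poly_norm w)\<^sup>2 \<le> (poly_norm u + poly_norm v + poly_norm w)\<^sup>2"
    by (simp add: power2_sum algebra_simps)
  then show ?thesis
    using fields by (simp add: real_le_lsqrt)
qed

text \<open>Coefficients are bounded by the norm, so each coefficient sequence is Cauchy. With a
  common degree bound only finitely many of them matter, and their limits assemble to a limit in
  norm.\<close>

lemma complete_poly_space:
  assumes s: "\<And>j. s j \<in> poly_space l"
    and Cauchy: "\<And>e. e > 0 \<Longrightarrow> \<exists>M. \<forall>a\<ge>M. \<forall>b\<ge>M. poly_norm (s a - s b) < e"
  shows "\<exists>f\<in>poly_space l. (\<lambda>j. poly_norm (s j - f)) \<longlonglongrightarrow> 0"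
proof -
  have "Cauchy (\<lambda>j. coeff (s j) i)" for i
  proof (rule CauchyI)
    fix e :: real assume "e > 0"
    then obtain M where M: "\<forall>a\<ge>M. \<forall>b\<ge>M. poly_norm (s a - s b) < e"
      using Cauchy by blast
    have "cmod (coeff (s a) i - coeff (s b) i) \<le> poly_norm (s a - s b)" for a b
      by (metis coeff_diff cmod_coeff_le)
    with M show "\<exists>M. \<forall>a\<ge>M. \<forall>b\<ge>M. cmod (coeff (s a) i - coeff (s b) i) < e"
      by (meson le_less_trans)
  qed
  then have lim: "(\<lambda>j. coeff (s j) i) \<longlonglongrightarrow> lim (\<lambda>j. coeff (s j) i)" for i
    by (simp add: Cauchy_convergent_iff convergent_LIMSEQ_iff)
  define f where "f = (\<Sum>i\<le>l. monom (lim (\<lambda>j. coeff (s j) i)) i)"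
  have coeff_f: "coeff f i = (if i \<le> l then lim (\<lambda>j. coeff (s j) i) else 0)" for i
    by (simp add: f_def coeff_sum)
  have f: "f \<in> poly_space l"
    by (auto simp: poly_space_def intro: degree_le simp: coeff_f)
  have "degree (s j - f) \<le> l" for j
    using s[of j] f by (intro degree_diff_le) (auto simp: poly_space_def)
  then have "(\<lambda>j. poly_norm (s j - f)) = (\<lambda>j. sqrt (\<Sum>i\<le>l. (cmod (coeff (s j) i - coeff f i))\<^sup>2))"
    by (simp add: poly_norm_eq_sum[of _ l])
  also have "\<dots> \<longlonglongrightarrow> sqrt (\<Sum>i\<le>l. (cmod (coeff f i - coeff f i))\<^sup>2)"
  proof (intro tendsto_intros)
    fix i assume "i \<in> {..l}"
    then show "(\<lambda>j. coeff (s j) i) \<longlonglongrightarrow> coeff f i"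
      using lim[of i] by (simp add: coeff_f)
  qed
  finally show ?thesis
    using f by auto
qed

lemma complete_triple_space: "triple.complete_on (triple_space k m n)"
  unfolding triple.complete_on_def
proof (intro allI impI)
  fix s :: "nat \<Rightarrow> poly_triple"
  assume s: "\<forall>j. s j \<in> triple_space k m n"
    and C: "\<forall>e>0. \<exists>M. \<forall>a\<ge>M. \<forall>b\<ge>M. triple_norm (s a - s b) < e"
  have "\<exists>u\<in>poly_space k. (\<lambda>j. poly_norm (fst (s j) - u)) \<longlonglongrightarrow> 0"
  proof (rule complete_poly_space)
    show "\<exists>M. \<forall>a\<ge>M. \<forall>b\<ge>M. poly_norm (fst (s a) - fst (s b)) < e" if "e > 0" for e
      using C that by (metis fst_diff poly_norm_le_triple_norm(1) le_less_trans)
  qed (use s in \<open>auto simp: triple_space_def mem_Times_iff\<close>)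
  moreover have "\<exists>v\<in>poly_space (m - k). (\<lambda>j. poly_norm (fst (snd (s j)) - v)) \<longlonglongrightarrow> 0"
  proof (rule complete_poly_space)
    show "\<exists>M. \<forall>a\<ge>M. \<forall>b\<ge>M. poly_norm (fst (snd (s a)) - fst (snd (s b))) < e" if "e > 0" for e
      using C that by (metis fst_diff snd_diff poly_norm_le_triple_norm(2) le_less_trans)
  qed (use s in \<open>auto simp: triple_space_def mem_Times_iff\<close>)
  moreover have "\<exists>w\<in>poly_space (n - k). (\<lambda>j. poly_norm (snd (snd (s j)) - w)) \<longlonglongrightarrow> 0"
  proof (rule complete_poly_space)
    show "\<exists>M. \<forall>a\<ge>M. \<forall>b\<ge>M. poly_norm (snd (snd (s a)) - snd (snd (s b))) < e" if "e > 0" for e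
      using C that by (metis snd_diff poly_norm_le_triple_norm(3) le_less_trans)
  qed (use s in \<open>auto simp: triple_space_def mem_Times_iff\<close>)
  ultimately obtain u v w where uvw: "u \<in> poly_space k" "v \<in> poly_space (m - k)" "w \<in> poly_space (n - k)"
    and lim: "(\<lambda>j. poly_norm (fst (s j) - u)) \<longlonglongrightarrow> 0"
      "(\<lambda>j. poly_norm (fst (snd (s j)) - v)) \<longlonglongrightarrow> 0"
      "(\<lambda>j. poly_norm (snd (snd (s j)) - w)) \<longlonglongrightarrow> 0"
    by blast
  have "(\<lambda>j. triple_norm (s j - (u, v, w))) \<longlonglongrightarrow> 0"
  proof (rule real_tendsto_sandwich[OF _ _ tendsto_const])
    show "(\<lambda>j. poly_norm (fst (s j) - u) + poly_norm (fst (snd (s j)) - v) + poly_norm (snd (snd (s j)) - w)) \<longlonglongrightarrow> 0"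
      using tendsto_add[OF tendsto_add[OF lim(1,2)] lim(3)] by simp
    show "\<forall>\<^sub>F j in sequentially. triple_norm (s j - (u, v, w))
        \<le> poly_norm (fst (s j) - u) + poly_norm (fst (snd (s j)) - v) + poly_norm (snd (snd (s j)) - w)"
      using triple_norm_le[of "s j - (u, v, w)" for j] by simp
  qed simp
  with uvw show "\<exists>l\<in>triple_space k m n. (\<lambda>j. triple_norm (s j - l)) \<longlonglongrightarrow> 0"
    by (auto simp: triple_space_def)
qed

section \<open>The derivative of the product map\<close>

fun gcd_product :: "poly_triple \<Rightarrow> poly_pair" where
  "gcd_product (u, v, w) = (u * v, u * w)"

fun gcd_differential :: "poly_triple \<Rightarrow> poly_triple \<Rightarrow> poly_pair" where
  "gcd_differential (u, v, w) (a, b, c) = (u * b + a * v, u * c + a * w)"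

lemma gcd_map_eq: "gcd_map z d = gcd_product z - d"
  by (cases z; cases d) simp

text \<open>The constant counts the four products in the differential. In each of them the first
  factor is a first component, of degree at most \<open>k\<close>, so
  \<open>poly_norm_mult_le\<close> contributes \<open>k + 1\<close>.\<close>

interpretation gcd: gauss_newton triple_inner pair_inner "triple_space k m n" gcd_differential
    gcd_product "4 * (real k + 1)"
  rewrites "inner_product.nrm triple_inner = triple_norm"
    and "inner_product.nrm pair_inner = pair_norm"
  for k m n
proof -
  have nt: "inner_product.nrm triple_inner = triple_norm"
    by (rule ext) (simp add: inner_product.nrm_def[OF inner_product_triple] flip: triple.nrm_power2)
  have np: "inner_product.nrm pair_inner = pair_norm"
    by (rule ext) (simp add: inner_product.nrm_def[OF inner_product_pair] flip: pair.nrm_power2)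
  have mult: "poly_norm (fst x * g) \<le> (real k + 1) * (triple_norm x * r)"
    if "x \<in> triple_space k m n" "poly_norm g \<le> r" for x g r
  proof -
    have "poly_norm (fst x * g) \<le> (real k + 1) * (poly_norm (fst x) * poly_norm g)"
      using poly_norm_mult_le[of "fst x" k g] that by (simp add: triple_space_def poly_space_def mem_Times_iff)
    also have "\<dots> \<le> (real k + 1) * (triple_norm x * r)"
      using that poly_norm_le_triple_norm[of x] by (intro mult_left_mono mult_mono) auto
    finally show ?thesis .
  qed
  have B: "pair_norm (gcd_differential x h) \<le> 4 * (real k + 1) * (triple_norm x * triple_norm h)"
    if "x \<in> triple_space k m n" "h \<in> triple_space k m n" for x h
  proof -
    have "pair_norm (gcd_differential x h) \<le> poly_norm (fst x * fst (snd h) + fst h * fst (snd x))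
        + poly_norm (fst x * snd (snd h) + fst h * snd (snd x))"
      using pair_norm_le[of "gcd_differential x h"] by (cases x; cases h) simp
    also have "\<dots> \<le> poly_norm (fst x * fst (snd h)) + poly_norm (fst h * fst (snd x))
        + (poly_norm (fst x * snd (snd h)) + poly_norm (fst h * snd (snd x)))"
      by (intro add_mono poly.nrm_triangle)
    also have "\<dots> \<le> (real k + 1) * (triple_norm x * triple_norm h) + (real k + 1) * (triple_norm h * triple_norm x)
        + ((real k + 1) * (triple_norm x * triple_norm h) + (real k + 1) * (triple_norm h * triple_norm x))"
      using that by (intro add_mono mult poly_norm_le_triple_norm)
    finally show ?thesis by (simp add: algebra_simps)
  qed
  have F: "pair_norm (gcd_product h) \<le> 4 * (real k + 1) * (triple_norm h)\<^sup>2"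
    if "h \<in> triple_space k m n" for h
  proof -
    have "pair_norm (gcd_product h) \<le> poly_norm (fst h * fst (snd h)) + poly_norm (fst h * snd (snd h))"
      using pair_norm_le[of "gcd_product h"] by (cases h) simp
    also have "\<dots> \<le> (real k + 1) * (triple_norm h * triple_norm h) + (real k + 1) * (triple_norm h * triple_norm h)"
      using that by (intro add_mono mult poly_norm_le_triple_norm)
    also have "\<dots> \<le> 4 * (real k + 1) * (triple_norm h)\<^sup>2"
      by (simp add: algebra_simps power2_eq_square)
    finally show ?thesis .
  qed
  show "gauss_newton triple_inner pair_inner (triple_space k m n) gcd_differential gcd_product (4 * (real k + 1))"
  proof (intro gauss_newton.intro inner_product_triple inner_product_pair gauss_newton_axioms.intro)
    show "inner_product.complete_on triple_inner (triple_space k m n)"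
      by (rule complete_triple_space)
    show "x - y \<in> triple_space k m n" if "x \<in> triple_space k m n" "y \<in> triple_space k m n" for x y
      using that by (auto simp: triple_space_def poly_space_def mem_Times_iff degree_diff_le)
    show "gcd_product (x + h) = gcd_product x + gcd_differential x h + gcd_product h" for x h
      by (cases x; cases h) (simp add: algebra_simps)
    show "gcd_differential (x - y) h = gcd_differential x h - gcd_differential y h" for x y h
      by (cases x; cases h; cases y) (simp add: algebra_simps)
  qed (use B F in \<open>simp_all add: nt np\<close>)
  show "inner_product.nrm triple_inner = triple_norm" "inner_product.nrm pair_inner = pair_norm"
    by (rule nt np)+
qed

section \<open>The gauge orbit\<close>

text \<open>The real form \<open>triple_inner\<close> cannot replace this one in orthogonality
  conditions: it would not detect the imaginary multiples of the tangent, which the differential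
  annihilates as well.\<close>

definition triple_cinner :: "poly_triple \<Rightarrow> poly_triple \<Rightarrow> complex" where
  "triple_cinner x y = poly_cinner (fst x) (fst y)
     + (poly_cinner (fst (snd x)) (fst (snd y)) + poly_cinner (snd (snd x)) (snd (snd y)))"

fun triple_smult :: "complex \<Rightarrow> poly_triple \<Rightarrow> poly_triple" where
  "triple_smult a (u, v, w) = (Polynomial.smult a u, Polynomial.smult a v, Polynomial.smult a w)"

text \<open>The tangent at \<open>t = 1\<close> of the curve \<open>(t u, v / t, w / t)\<close>, along which the product map is constant.\<close>

fun gauge_tangent :: "poly_triple \<Rightarrow> poly_triple" where
  "gauge_tangent (u, v, w) = (u, - v, - w)"

text \<open>Since \<open>1 / 0 = 0\<close>, the parameter zero yields the zero triple, which is off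
  the curve; hence the side conditions \<open>t \<noteq> 0\<close>.\<close>

fun gauge_orbit :: "complex \<Rightarrow> poly_triple \<Rightarrow> poly_triple" where
  "gauge_orbit t (u, v, w) = (Polynomial.smult t u, Polynomial.smult (1 / t) v, Polynomial.smult (1 / t) w)"

lemma poly_cinner_diff_left: "poly_cinner (f - g) h = poly_cinner f h - poly_cinner g h"
  using poly_cinner_add_left[of f "- g" h] by (simp add: poly_cinner_minus_left)

lemma poly_cinner_diff_right: "poly_cinner h (f - g) = poly_cinner h f - poly_cinner h g"
  using poly_cinner_add_right[of h f "- g"] by (simp add: poly_cinner_minus_right)

lemma triple_inner_eq_Re: "triple_inner x y = Re (triple_cinner x y)"
  by (simp add: triple_inner_def pair_inner_def poly_inner_def triple_cinner_def)

lemma triple_cinner_self: "triple_cinner x x = of_real ((triple_norm x)\<^sup>2)"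
  by (simp add: triple_cinner_def poly_cinner_self triple.nrm_power2 triple_inner_def
      pair_inner_def poly.nrm_power2[symmetric])

lemma triple_cinner_smult_left: "triple_cinner (triple_smult a x) y = a * triple_cinner x y"
  by (cases x) (simp add: triple_cinner_def poly_cinner_smult_left algebra_simps)

lemma triple_cinner_diff_left: "triple_cinner (x - y) z = triple_cinner x z - triple_cinner y z"
  by (simp add: triple_cinner_def poly_cinner_diff_left)

lemma triple_cinner_diff_right: "triple_cinner z (x - y) = triple_cinner z x - triple_cinner z y"
  by (simp add: triple_cinner_def poly_cinner_diff_right)

lemma triple_norm_smult: "triple_norm (triple_smult a x) = cmod a * triple_norm x"
proof (cases x)
  case (fields u v w)
  have "(poly_norm (Polynomial.smult a u))\<^sup>2 + (poly_norm (Polynomial.smult a v))\<^sup>2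
      + (poly_norm (Polynomial.smult a w))\<^sup>2
      = (cmod a)\<^sup>2 * ((poly_norm u)\<^sup>2 + (poly_norm v)\<^sup>2 + (poly_norm w)\<^sup>2)"
    by (simp add: poly_norm_smult power_mult_distrib distrib_left)
  with fields show ?thesis
    by (simp add: real_sqrt_mult)
qed

text \<open>Rotating \<open>x\<close> by the phase \<open>cnj (sgn c)\<close> makes the complex
  product real and nonnegative, which reduces the claim to the real inequality. As
  \<open>sgn 0 = 0\<close>, no case distinction arises.\<close>

lemma triple_cinner_le: "cmod (triple_cinner x y) \<le> triple_norm x * triple_norm y"
proof -
  define c where "c = triple_cinner x y"
  have "cnj (sgn c) * c = (c * cnj c) / of_real (cmod c)"
    by (simp add: sgn_eq)
  also have "\<dots> = of_real (cmod c)"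
    unfolding complex_norm_square[symmetric] by (simp add: power2_eq_square)
  finally have "cmod c = triple_inner (triple_smult (cnj (sgn c)) x) y"
    by (simp add: triple_inner_eq_Re triple_cinner_smult_left c_def)
  also have "\<dots> \<le> triple_norm (triple_smult (cnj (sgn c)) x) * triple_norm y"
    using triple.ip_le_nrm by (meson abs_le_D1)
  also have "\<dots> \<le> triple_norm x * triple_norm y"
    by (intro mult_right_mono) (auto simp: triple_norm_smult norm_sgn)
  finally show ?thesis by (simp add: c_def)
qed

lemma triple_norm_gauge: "triple_norm (gauge_tangent z) = triple_norm z"
  by (cases z) simp

lemma gauge_diff: "gauge_tangent (x - y) = gauge_tangent x - gauge_tangent y"
  by (cases x; cases y) simp

lemma gcd_differential_gauge: "gcd_differential z (gauge_tangent z) = 0"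
  by (cases z) (simp add: zero_prod_def)

lemma gcd_differential_gauge_smult: "gcd_differential z (triple_smult a (gauge_tangent z)) = 0"
  by (cases z) (simp add: zero_prod_def)

lemma gcd_differential_diff_right:
  "gcd_differential z (x - y) = gcd_differential z x - gcd_differential z y"
  by (cases x; cases y; cases z) (simp add: algebra_simps)

lemma gauge_mem: "z \<in> triple_space k m n \<Longrightarrow> gauge_tangent z \<in> triple_space k m n"
  by (cases z) (simp add: triple_space_def poly_space_def)

lemma triple_smult_mem: "z \<in> triple_space k m n \<Longrightarrow> triple_smult a z \<in> triple_space k m n"
  by (cases z) (auto simp: triple_space_def poly_space_def intro: order_trans[OF degree_smult_le])

lemma orbit_mem: "z \<in> triple_space k m n \<Longrightarrow> gauge_orbit t z \<in> triple_space k m n"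
  by (cases z) (auto simp: triple_space_def poly_space_def intro: order_trans[OF degree_smult_le])

lemma gcd_product_orbit: "t \<noteq> 0 \<Longrightarrow> gcd_product (gauge_orbit t z) = gcd_product z"
  by (cases z) simp

lemma gcd_product_diff: "gcd_product (z - h) = gcd_product z - gcd_differential z h + gcd_product h"
  by (cases z; cases h) (simp add: algebra_simps)

text \<open>A vector orthogonal to the tangent at \<open>y\<close> is almost orthogonal to the one
  at \<open>z\<close>; removing its component along the latter does not change the differential at
  \<open>z\<close>. With \<open>\<epsilon>\<close> the distance of \<open>y\<close> from
  \<open>z\<close>, that component costs \<open>\<epsilon> / N\<close> and the change of
  differential \<open>\<kappa> * \<mu> * \<epsilon>\<close> relative to \<open>h\<close>. Together
  this is \<open>s * \<epsilon>\<close>, at most 1/3 by the choice of radius, whence the factor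
  3/2.\<close>

lemma coercive_near:
  assumes z: "z \<in> triple_space k m n" "z \<noteq> 0" and \<kappa>: "0 < \<kappa>"
    and coercive: "\<And>h. h \<in> triple_space k m n \<Longrightarrow> triple_cinner h (gauge_tangent z) = 0 \<Longrightarrow>
      triple_norm h \<le> \<kappa> * pair_norm (gcd_differential z h)"
  obtains \<rho> where "0 < \<rho>"
    "\<And>y h. y \<in> triple_space k m n \<Longrightarrow> triple_norm (y - z) < \<rho> \<Longrightarrow> h \<in> triple_space k m n \<Longrightarrow>
      triple_cinner h (gauge_tangent y) = 0 \<Longrightarrow> triple_norm h \<le> 3 / 2 * \<kappa> * pair_norm (gcd_differential y h)"
proof
  define N where "N = triple_norm z"
  define \<mu> where "\<mu> = 4 * (real k + 1)"
  define s where "s = 1 / N + \<kappa> * \<mu>"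
  have N: "0 < N" using z by (simp add: N_def)
  have \<mu>: "0 < \<mu>" by (simp add: \<mu>_def)
  have s: "0 < s"
    using N \<kappa> \<mu> by (simp add: s_def add_pos_pos)
  show "0 < 1 / (3 * s)"
    using s by simp
  fix y h
  assume y: "y \<in> triple_space k m n" and near: "triple_norm (y - z) < 1 / (3 * s)"
    and h: "h \<in> triple_space k m n" and orth: "triple_cinner h (gauge_tangent y) = 0"
  define \<epsilon> where "\<epsilon> = triple_norm (y - z)"
  define a where "a = triple_cinner h (gauge_tangent z) / of_real (N\<^sup>2)"
  define h' where "h' = h - triple_smult a (gauge_tangent z)"
  have h': "h' \<in> triple_space k m n"
    unfolding h'_def using h z by (intro gcd.diff_mem triple_smult_mem gauge_mem)
  have "triple_cinner h' (gauge_tangent z) = 0"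
    using N by (simp add: h'_def triple_cinner_diff_left triple_cinner_smult_left triple_cinner_self
        triple_norm_gauge a_def flip: N_def)
  from coercive[OF h' this] have "triple_norm h' \<le> \<kappa> * pair_norm (gcd_differential z h)"
    by (simp add: h'_def gcd_differential_diff_right gcd_differential_gauge_smult)
  also have "gcd_differential z h = gcd_differential y h - gcd_differential (y - z) h"
    by (simp add: gcd.B_diff_left)
  also have "pair_norm \<dots> \<le> pair_norm (gcd_differential y h) + \<mu> * (\<epsilon> * triple_norm h)"
    using pair.nrm_diff_le[of "gcd_differential y h" "gcd_differential (y - z) h"]
      gcd.B_bound[OF gcd.diff_mem[OF y z(1)] h] by (simp add: \<mu>_def \<epsilon>_def)
  finally have 1: "triple_norm h' \<le> \<kappa> * (pair_norm (gcd_differential y h) + \<mu> * (\<epsilon> * triple_norm h))"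
    using \<kappa> by simp
  \<comment> \<open>By \<open>orth\<close> only the difference of the two tangents contributes, and
    its norm is \<open>\<epsilon>\<close>.\<close>
  have "triple_cinner h (gauge_tangent z) = triple_cinner h (gauge_tangent (z - y))"
    by (simp add: gauge_diff triple_cinner_diff_right orth)
  then have "cmod (triple_cinner h (gauge_tangent z)) \<le> triple_norm h * \<epsilon>"
    using triple_cinner_le[of h "gauge_tangent (z - y)"]
    by (simp add: triple_norm_gauge \<epsilon>_def triple.nrm_minus_commute)
  moreover have "cmod a * N = cmod (triple_cinner h (gauge_tangent z)) / N"
    using N unfolding a_def norm_divide norm_of_real by (simp add: power2_eq_square)
  ultimately have "cmod a * N \<le> triple_norm h * \<epsilon> / N"
    using N by (simp add: divide_right_mono)
  then have 2: "triple_norm h - triple_norm h' \<le> triple_norm h * \<epsilon> / N"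
    using triple.nrm_triangle[of h' "triple_smult a (gauge_tangent z)"]
    by (simp add: h'_def triple_norm_smult triple_norm_gauge N_def)
  have "triple_norm h \<le> \<kappa> * pair_norm (gcd_differential y h) + (s * \<epsilon>) * triple_norm h"
    using 1 2 by (simp add: s_def algebra_simps)
  also have "(s * \<epsilon>) * triple_norm h \<le> 1 / 3 * triple_norm h"
    using near s by (intro mult_right_mono) (auto simp: \<epsilon>_def field_simps)
  finally show "triple_norm h \<le> 3 / 2 * \<kappa> * pair_norm (gcd_differential y h)"
    by simp
qed

text \<open>Since the product of the distances of the roots from \<open>1\<close> is \<open>\<bar>(a + b + c) / a\<bar>\<close>, one of them is
  close to \<open>1\<close> when the polynomial almost vanishes there.\<close>

lemma quadratic_root_near_1:
  fixes a b c :: complex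
  assumes "a \<noteq> 0"
  obtains t where "a * t\<^sup>2 + b * t + c = 0" "cmod a * (cmod (1 - t))\<^sup>2 \<le> cmod (a + b + c)"
proof -
  define D where "D = csqrt (b\<^sup>2 - 4 * a * c)"
  have D: "D\<^sup>2 = b\<^sup>2 - 4 * a * c" by (simp add: D_def)
  define r s where "r = (- b + D) / (2 * a)" and "s = (- b - D) / (2 * a)"
  have "4 * a * (a * (r * s)) = (2 * a * r) * (2 * a * s)"
    by simp
  also have "\<dots> = (- b + D) * (- b - D)"
    using assms by (simp add: r_def s_def)
  also have "\<dots> = 4 * a * c"
    using D by (simp add: algebra_simps power2_eq_square)
  finally have rs: "a * (r + s) = - b" "a * (r * s) = c"
    using assms by (simp_all add: r_def s_def field_simps)
  have fact: "a * x\<^sup>2 + b * x + c = a * ((x - r) * (x - s))" for x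
  proof -
    have "a * ((x - r) * (x - s)) = a * x\<^sup>2 - a * (r + s) * x + a * (r * s)"
      by (simp add: algebra_simps power2_eq_square)
    then show ?thesis
      unfolding rs by simp
  qed
  have 1: "cmod (a + b + c) = cmod a * (cmod (1 - r) * cmod (1 - s))"
    using fact[of 1] by (simp add: norm_mult)
  show ?thesis
  proof (cases "cmod (1 - r) \<le> cmod (1 - s)")
    case True
    then have "cmod a * (cmod (1 - r))\<^sup>2 \<le> cmod (a + b + c)"
      unfolding 1 power2_eq_square by (intro mult_left_mono) auto
    then show ?thesis using that[of r] fact[of r] by simp
  next
    case False
    then have "cmod a * (cmod (1 - s))\<^sup>2 \<le> cmod (a + b + c)"
      unfolding 1 power2_eq_square by (intro mult_left_mono mult_right_mono) auto
    then show ?thesis using that[of s] fact[of s] by simp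
  qed
qed

lemma poly_cinner_le: "cmod (poly_cinner f g) \<le> poly_norm f * poly_norm g"
  using triple_cinner_le[of "(f, 0, 0)" "(g, 0, 0)"]
  by (simp add: triple_cinner_def poly_cinner_def)

text \<open>Multiplied by \<open>t\<close>, the orthogonality condition becomes
  \<open>\<alpha> * t\<^sup>2 - \<beta> * t - \<gamma> = 0\<close>. At \<open>t = 1\<close> the left
  side is small because \<open>x\<close> is close to \<open>z\<close>, while \<open>\<alpha>\<close>
  stays away from zero because the first component of \<open>z\<close> does not vanish. So some root
  is close to 1, and the corresponding point of the curve is close to \<open>z\<close>.\<close>

lemma orbit_near:
  assumes "fst z \<noteq> 0" and \<eta>: "0 < \<eta>"
  obtains \<epsilon> where "0 < \<epsilon>" "\<And>x. triple_norm (x - z) < \<epsilon> \<Longrightarrow>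
    \<exists>t. t \<noteq> 0 \<and> triple_cinner (x - gauge_orbit t z) (gauge_tangent x) = 0 \<and> triple_norm (x - gauge_orbit t z) < \<eta>"
proof -
  obtain u v w where z: "z = (u, v, w)" by (cases z)
  define N where "N = triple_norm z"
  define U where "U = poly_norm u"
  \<comment> \<open>The target for \<open>cmod (1 - t)\<close>: the bound 1/2 keeps \<open>t\<close>
    away from zero, the other one keeps the displacement along the curve, at most
    \<open>5 * \<theta> * N\<close>, below \<open>\<eta> / 2\<close>.\<close>
  define \<theta> where "\<theta> = min (1 / 2) (\<eta> / (12 * (N + 1)))"
  \<comment> \<open>In order: a lower bound for \<open>\<alpha>\<close>, the bound
    \<open>N + 1\<close> for the norm of \<open>x\<close>, the other half of \<open>\<eta>\<close>,
    and the smallness at \<open>t = 1\<close> that forces a root within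
    \<open>\<theta>\<close>.\<close>
  define \<epsilon> where "\<epsilon> = min (min (U / 2) 1) (min (\<eta> / 2) (\<theta>\<^sup>2 * U\<^sup>2 / (2 * (N + 1))))"
  have N: "0 \<le> N" by (simp add: N_def)
  have U: "0 < U" using assms z by (simp add: U_def)
  have \<theta>: "0 < \<theta>" "\<theta> \<le> 1 / 2" "\<theta> * (12 * (N + 1)) \<le> \<eta>"
  proof -
    show "\<theta> \<le> 1 / 2"
      unfolding \<theta>_def by (rule min.cobounded1)
    have "\<theta> \<le> \<eta> / (12 * (N + 1))"
      by (simp add: \<theta>_def)
    then show "\<theta> * (12 * (N + 1)) \<le> \<eta>"
      using N by (subst (asm) pos_le_divide_eq) auto
  qed (use \<eta> N in \<open>auto simp: \<theta>_def\<close>)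
  have "0 < \<epsilon>" using U \<eta> \<theta> N by (simp add: \<epsilon>_def)
  moreover have "\<exists>t. t \<noteq> 0 \<and> triple_cinner (x - gauge_orbit t z) (gauge_tangent x) = 0 \<and> triple_norm (x - gauge_orbit t z) < \<eta>"
    if "triple_norm (x - z) < \<epsilon>" for x
  proof -
    define e where "e = triple_norm (x - z)"
    have e: "0 \<le> e" "e < U / 2" "e < 1" "e < \<eta> / 2" "e < \<theta>\<^sup>2 * U\<^sup>2 / (2 * (N + 1))"
      using that by (auto simp: e_def \<epsilon>_def)
    obtain a b c where x: "x = (a, b, c)" by (cases x)
    define \<alpha> where "\<alpha> = poly_cinner u a"
    define \<beta> where "\<beta> = triple_cinner x (gauge_tangent x)"
    define \<gamma> where "\<gamma> = poly_cinner v b + poly_cinner w c"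
    have "U\<^sup>2 / 2 \<le> cmod \<alpha>"
    proof -
      have "\<alpha> = of_real (U\<^sup>2) + poly_cinner u (a - u)"
        using poly_cinner_add_right[of u "a - u" u] by (simp add: \<alpha>_def U_def poly_cinner_self)
      then have "U\<^sup>2 - cmod (poly_cinner u (a - u)) \<le> cmod \<alpha>"
        using norm_diff_ineq[of "of_real (U\<^sup>2)" "poly_cinner u (a - u)"] by (simp add: norm_power)
      moreover have "poly_norm (a - u) \<le> e"
        using poly_norm_le_triple_norm(1)[of "x - z"] by (simp add: x z e_def)
      then have "U * poly_norm (a - u) \<le> U * (U / 2)"
        using e(2) U by (intro mult_left_mono) auto
      then have "cmod (poly_cinner u (a - u)) \<le> U * (U / 2)"
        using poly_cinner_le[of u "a - u"] unfolding U_def by linarith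
      ultimately show ?thesis by (simp add: power2_eq_square)
    qed
    then have \<alpha>: "\<alpha> \<noteq> 0" "U\<^sup>2 / 2 \<le> cmod \<alpha>"
      using U by auto
    obtain t where t: "\<alpha> * t\<^sup>2 + (- \<beta>) * t + (- \<gamma>) = 0"
      "cmod \<alpha> * (cmod (1 - t))\<^sup>2 \<le> cmod (\<alpha> + (- \<beta>) + (- \<gamma>))"
      using quadratic_root_near_1[OF \<alpha>(1)] by blast
    have "triple_norm x \<le> N + 1"
      using triple.nrm_triangle[of z "x - z"] e by (simp add: e_def N_def)
    \<comment> \<open>The value of the quadratic at 1 is the failure of \<open>z\<close> itself to
      satisfy the orthogonality condition, up to sign.\<close>
    moreover have "\<alpha> + (- \<beta>) + (- \<gamma>) = triple_cinner (z - x) (gauge_tangent x)"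
      unfolding triple_cinner_diff_left \<beta>_def
      by (simp add: z x triple_cinner_def \<alpha>_def \<gamma>_def poly_cinner_smult_left poly_cinner_minus_right)
    ultimately have "cmod (\<alpha> + (- \<beta>) + (- \<gamma>)) \<le> e * (N + 1)"
      using triple_cinner_le[of "z - x" "gauge_tangent x"] e
      by (metis e_def triple.nrm_minus_commute triple_norm_gauge mult_left_mono order_trans)
    then have "U\<^sup>2 / 2 * (cmod (1 - t))\<^sup>2 \<le> e * (N + 1)"
      using t(2) \<alpha>(2) mult_right_mono[OF \<alpha>(2), of "(cmod (1 - t))\<^sup>2"] by simp
    also have "\<dots> \<le> U\<^sup>2 / 2 * \<theta>\<^sup>2"
      using e(5) N by (simp add: field_simps)
    finally have "(cmod (1 - t))\<^sup>2 \<le> \<theta>\<^sup>2"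
      using U by simp
    then have t1: "cmod (1 - t) \<le> \<theta>"
      by (rule power2_le_imp_le) (use \<theta> in simp)
    have ht: "1 / 2 \<le> cmod t"
      using t1 \<theta> norm_triangle_ineq2[of 1 "1 - t"] by simp
    then have t0: "t \<noteq> 0" by auto
    have inv: "cmod (1 - 1 / t) \<le> 2 * \<theta>"
    proof -
      have "1 - 1 / t = (t - 1) / t"
        using t0 by (simp add: diff_divide_distrib)
      then have "cmod (1 - 1 / t) = cmod (1 - t) / cmod t"
        by (simp add: norm_divide norm_minus_commute)
      also have "\<dots> \<le> \<theta> / (1 / 2)"
        using t1 ht \<theta> by (intro frac_le) auto
      finally show ?thesis by simp
    qed
    have "triple_norm (z - gauge_orbit t z) \<le> cmod (1 - t) * poly_norm u + cmod (1 - 1 / t) * poly_norm v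
        + cmod (1 - 1 / t) * poly_norm w"
    proof -
      have "f - Polynomial.smult r f = Polynomial.smult (1 - r) f" for r and f :: "complex poly"
        by (simp add: smult_diff_left)
      then have "z - gauge_orbit t z = (Polynomial.smult (1 - t) u, Polynomial.smult (1 - 1 / t) v,
          Polynomial.smult (1 - 1 / t) w)"
        by (simp add: z)
      then show ?thesis
        using triple_norm_le[of "z - gauge_orbit t z"] by (simp only: fst_conv snd_conv poly_norm_smult)
    qed
    also have "\<dots> \<le> \<theta> * N + 2 * \<theta> * N + 2 * \<theta> * N"
      using poly_norm_le_triple_norm[of z] t1 inv \<theta>
      by (intro add_mono mult_mono) (auto simp: z N_def)
    also have "\<dots> < \<eta> / 2"
    proof -
      have "0 \<le> \<theta> * N" "12 * (\<theta> * N) + 12 * \<theta> \<le> \<eta>"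
        using \<theta> N by (simp_all add: algebra_simps)
      then show ?thesis
        using \<theta>(1) by linarith
    qed
    finally have "triple_norm (x - gauge_orbit t z) < \<eta>"
      using e(4) triple.nrm_triangle_diff[of x "gauge_orbit t z" z] by (simp add: e_def)
    moreover have "triple_cinner (x - gauge_orbit t z) (gauge_tangent x) = 0"
    proof -
      have "t * triple_cinner (x - gauge_orbit t z) (gauge_tangent x) = t * \<beta> - t * triple_cinner (gauge_orbit t z) (gauge_tangent x)"
        by (simp add: triple_cinner_diff_left \<beta>_def right_diff_distrib)
      also have "triple_cinner (gauge_orbit t z) (gauge_tangent x) = t * \<alpha> - 1 / t * \<gamma>"
        by (simp add: z x triple_cinner_def \<alpha>_def \<gamma>_def poly_cinner_smult_left poly_cinner_minus_right algebra_simps add_divide_distrib)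
      also have "t * \<beta> - t * (t * \<alpha> - 1 / t * \<gamma>) = - (\<alpha> * t\<^sup>2 + (- \<beta>) * t + (- \<gamma>))"
        using t0 by (simp add: algebra_simps power2_eq_square)
      finally show ?thesis
        using t(1) t0 by simp
    qed
    ultimately show ?thesis
      using t0 by blast
  qed
  ultimately show ?thesis using that by blast
qed

section \<open>Convergence to an approximate greatest common divisor\<close>

text \<open>The correction \<open>H\<close> is arbitrary apart from being a Gauss-Newton step
  wherever the differential is coercive with the weakened constant, so matrices do not occur here.
  The factor in the bound is 4/3 from \<open>gcd.stationary_error\<close> times 3/2 from
  \<open>coercive_near\<close>.\<close>

lemma gcd_newton_converges:
  assumes z: "z \<in> triple_space k m n" "fst z \<noteq> 0" "gcd_product z = p" and \<kappa>: "0 < \<kappa>"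
    and coercive: "\<And>h. h \<in> triple_space k m n \<Longrightarrow> triple_cinner h (gauge_tangent z) = 0 \<Longrightarrow>
      triple_norm h \<le> \<kappa> * pair_norm (gcd_differential z h)"
    and step: "\<And>d y. y \<in> triple_space k m n \<Longrightarrow> d \<in> D \<Longrightarrow> y \<noteq> 0 \<Longrightarrow>
      (\<And>h. h \<in> triple_space k m n \<Longrightarrow> triple_cinner h (gauge_tangent y) = 0 \<Longrightarrow>
        triple_norm h \<le> 3 / 2 * \<kappa> * pair_norm (gcd_differential y h)) \<Longrightarrow>
      gcd.gauss_newton_step k m n d (3 / 2 * \<kappa>) y (H d y)"
  shows "\<exists>\<delta>>0. \<forall>d\<in>D. \<forall>s. s 0 \<in> triple_space k m n \<longrightarrow> (\<forall>j. s (Suc j) = s j + H d (s j)) \<longrightarrow>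
    pair_norm (d - p) < \<delta> \<longrightarrow> triple_norm (s 0 - z) < \<delta> \<longrightarrow>
    (\<exists>x\<in>triple_space k m n. triple_converges s x \<and>
      (\<exists>t. t \<noteq> 0 \<and> triple_norm (x - gauge_orbit t z) \<le> 2 * \<kappa> * pair_norm (d - p)) \<and>
      (d = p \<longrightarrow> quadratic_rate s x))"
proof -
  let ?V = "triple_space k m n"
  define N where "N = triple_norm z"
  define \<mu> where "\<mu> = 4 * (real k + 1)"
  define \<sigma> where "\<sigma> = 3 / 2 * \<kappa>"
  define \<tau> where "\<tau> = 1 / (4 * \<sigma>\<^sup>2 * \<mu>)"
  have z0: "z \<noteq> 0" using z by auto
  have N: "0 < N" using z0 by (simp add: N_def)
  have \<mu>: "0 < \<mu>" by (simp add: \<mu>_def)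
  have \<sigma>: "0 < \<sigma>" using \<kappa> by (simp add: \<sigma>_def)
  have \<tau>: "0 < \<tau>" using \<mu> \<sigma> by (simp add: \<tau>_def)
  obtain \<rho>1 where \<rho>1: "0 < \<rho>1" and near: "\<And>y h. y \<in> ?V \<Longrightarrow> triple_norm (y - z) < \<rho>1 \<Longrightarrow> h \<in> ?V \<Longrightarrow>
      triple_cinner h (gauge_tangent y) = 0 \<Longrightarrow> triple_norm h \<le> \<sigma> * pair_norm (gcd_differential y h)"
    using coercive_near[OF z(1) z0 \<kappa> coercive] unfolding \<sigma>_def by metis
  \<comment> \<open>This radius is what the smallness condition of
    \<open>gcd.stationary_error\<close> demands of the distance between limit and curve.\<close>
  have "0 < 1 / (4 * \<sigma> * \<mu>)" using \<sigma> \<mu> by simp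
  then obtain \<rho>2 where \<rho>2: "0 < \<rho>2" and gauge_orbit: "\<And>x. triple_norm (x - z) < \<rho>2 \<Longrightarrow>
      \<exists>t. t \<noteq> 0 \<and> triple_cinner (x - gauge_orbit t z) (gauge_tangent x) = 0
        \<and> triple_norm (x - gauge_orbit t z) < 1 / (4 * \<sigma> * \<mu>)"
    using orbit_near[OF z(2)] by metis
  \<comment> \<open>Besides the two radii above: 1 bounds the norm in the Lipschitz estimate by
    \<open>N + 1\<close>, \<open>N\<close> excludes the zero triple, whose tangent vanishes, and the
    last term leaves half of the admissible residual \<open>\<tau>\<close> to the data
    error.\<close>
  define \<rho> where "\<rho> = min (min \<rho>1 \<rho>2) (min (min 1 N) (\<tau> / (2 * \<mu> * (N + 1))))"
  have \<rho>: "0 < \<rho>" "\<rho> \<le> \<rho>1" "\<rho> \<le> \<rho>2" "\<rho> \<le> 1" "\<rho> \<le> N" "\<mu> * (N + 1) * \<rho> \<le> \<tau> / 2"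
  proof -
    have "\<rho> \<le> \<tau> / (2 * \<mu> * (N + 1))"
      by (simp add: \<rho>_def)
    then have "\<rho> * (2 * \<mu> * (N + 1)) \<le> \<tau>"
      using N \<mu> by (subst (asm) pos_le_divide_eq) auto
    then show "\<mu> * (N + 1) * \<rho> \<le> \<tau> / 2"
      by (simp add: mult_ac)
  qed (use \<rho>1 \<rho>2 N \<mu> \<tau> in \<open>auto simp: \<rho>_def\<close>)
  \<comment> \<open>Initial distance plus twice the first step, per unit of
    \<open>\<delta>\<close>.\<close>
  define s1 where "s1 = 1 + 2 * \<sigma> * (\<mu> * (N + 1) + 1)"
  have s1: "1 \<le> s1" using \<sigma> \<mu> N by (simp add: s1_def)
  define \<delta> where "\<delta> = min (\<tau> / 2) (\<rho> / s1)"
  have \<delta>: "0 < \<delta>" "\<delta> \<le> \<tau> / 2" "\<delta> * s1 \<le> \<rho>"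
  proof -
    show "\<delta> \<le> \<tau> / 2"
      unfolding \<delta>_def by (rule min.cobounded1)
    have "\<delta> \<le> \<rho> / s1"
      by (simp add: \<delta>_def)
    then show "\<delta> * s1 \<le> \<rho>"
      using s1 by (subst (asm) pos_le_divide_eq) auto
  qed (use \<tau> \<rho> s1 in \<open>auto simp: \<delta>_def\<close>)
  have \<delta>\<rho>: "\<delta> \<le> \<rho>"
    using \<delta> mult_left_mono[OF s1, of \<delta>] by linarith
  have prod_near: "pair_norm (gcd_product x - p) \<le> \<mu> * (N + 1) * triple_norm (x - z)"
    if "x \<in> ?V" "triple_norm (x - z) < \<rho>" for x
  proof -
    have "pair_norm (gcd_product x - p) \<le> \<mu> * (N + triple_norm (x - z)) * triple_norm (x - z)"
      using gcd.F_diff_bound[OF z(1) that(1)] by (simp add: z N_def \<mu>_def)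
    also have "\<dots> \<le> \<mu> * (N + 1) * triple_norm (x - z)"
      using that \<rho>(4) \<mu> by (intro mult_right_mono mult_left_mono) auto
    finally show ?thesis .
  qed
  show ?thesis
  proof (intro exI[of _ \<delta>] conjI \<delta>(1) ballI allI impI)
    fix d s
    assume d: "d \<in> D" and s0: "s 0 \<in> ?V" and sS: "\<forall>j. s (Suc j) = s j + H d (s j)"
      and d_near: "pair_norm (d - p) < \<delta>" and s_near: "triple_norm (s 0 - z) < \<delta>"
    have res: "pair_norm (gcd_product x - d) \<le> \<mu> * (N + 1) * triple_norm (x - z) + pair_norm (d - p)"
      if "x \<in> ?V" "triple_norm (x - z) < \<rho>" for x
      using pair.nrm_triangle_diff[of "gcd_product x" d p] prod_near[OF that]
        pair.nrm_minus_commute[of d p] by linarith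
    have st: "gcd.gauss_newton_step k m n d \<sigma> x (H d x)"
      if "x \<in> ?V" "triple_norm (x - z) < \<rho>" for x
      unfolding \<sigma>_def
    proof (rule step[OF that(1) d])
      show "x \<noteq> 0"
        using that(2) \<rho>(5) triple.nrm_minus[of z] by (auto simp: N_def)
      show "triple_norm h \<le> 3 / 2 * \<kappa> * pair_norm (gcd_differential x h)"
        if "h \<in> ?V" "triple_cinner h (gauge_tangent x) = 0" for h
        using near[of x h] that \<open>x \<in> ?V\<close> \<open>triple_norm (x - z) < \<rho>\<close> \<rho>(2) by (simp add: \<sigma>_def)
    qed
    have s0\<rho>: "triple_norm (s 0 - z) < \<rho>"
      using s_near \<delta>\<rho> by simp
    interpret it: gauss_newton_iteration triple_inner pair_inner "triple_space k m n" gcd_differential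
        gcd_product "4 * (real k + 1)" d z \<rho> \<sigma> "H d" s
      rewrites "inner_product.nrm triple_inner = triple_norm"
        and "inner_product.nrm pair_inner = pair_norm"
    proof -
      show nt: "inner_product.nrm triple_inner = triple_norm"
        by (rule ext) (simp add: inner_product.nrm_def[OF inner_product_triple] flip: triple.nrm_power2)
      show np: "inner_product.nrm pair_inner = pair_norm"
        by (rule ext) (simp add: inner_product.nrm_def[OF inner_product_pair] flip: pair.nrm_power2)
      show "gauss_newton_iteration triple_inner pair_inner (triple_space k m n) gcd_differential
          gcd_product (4 * (real k + 1)) d z \<rho> \<sigma> (H d) s"
      proof (intro gauss_newton_iteration.intro gauss_newton_iteration_axioms.intro, unfold nt np)
        show "gauss_newton triple_inner pair_inner (triple_space k m n) gcd_differential gcd_product (4 * (real k + 1))"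
          by (rule gcd.gauss_newton_axioms)
        show "pair_norm (gcd_product x - d) \<le> 1 / (4 * \<sigma>\<^sup>2 * (4 * (real k + 1)))"
          if "x \<in> ?V" "triple_norm (x - z) < \<rho>" for x
        proof -
          have "\<mu> * (N + 1) * triple_norm (x - z) \<le> \<mu> * (N + 1) * \<rho>"
            using that(2) \<mu> N by (intro mult_left_mono) auto
          then have "pair_norm (gcd_product x - d) \<le> \<tau> / 2 + \<tau> / 2"
            using res[OF that] \<rho>(6) d_near \<delta>(2) by linarith
          then show ?thesis by (simp add: \<tau>_def \<mu>_def)
        qed
        show "triple_norm (s 0 - z) + 2 * triple_norm (H d (s 0)) < \<rho>"
        proof -
          have "triple_norm (H d (s 0)) \<le> \<sigma> * pair_norm (gcd_product (s 0) - d)"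
            using gcd.step_le[OF st[OF s0 s0\<rho>]] \<sigma> by simp
          also have "\<dots> \<le> \<sigma> * (\<mu> * (N + 1) * triple_norm (s 0 - z) + pair_norm (d - p))"
            using res[OF s0 s0\<rho>] \<sigma> by simp
          also have "\<dots> \<le> \<sigma> * (\<mu> * (N + 1) * \<delta> + \<delta>)"
            using s_near d_near \<mu> N \<sigma> by (intro mult_left_mono add_mono) auto
          finally have "triple_norm (s 0 - z) + 2 * triple_norm (H d (s 0)) < \<delta> + 2 * (\<sigma> * (\<mu> * (N + 1) * \<delta> + \<delta>))"
            using s_near by linarith
          also have "\<dots> = \<delta> * s1"
            by (simp add: s1_def algebra_simps)
          finally show ?thesis using \<delta>(3) by simp
        qed
      qed (use \<sigma> st s0 sS in auto)
    qed
    obtain x where x: "x \<in> ?V" and lim: "(\<lambda>j. triple_norm (s j - x)) \<longlonglongrightarrow> 0"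
      using it.converges by blast
    have x_near: "triple_norm (x - z) < \<rho>"
      using it.limit_near[OF x lim] it.y_0(2) by linarith
    obtain t where t: "t \<noteq> 0" "triple_cinner (x - gauge_orbit t z) (gauge_tangent x) = 0"
      "triple_norm (x - gauge_orbit t z) < 1 / (4 * \<sigma> * \<mu>)"
      using gauge_orbit[of x] x_near \<rho>(3) by auto
    define h where "h = x - gauge_orbit t z"
    have h: "h \<in> ?V"
      unfolding h_def by (intro gcd.diff_mem x orbit_mem z)
    have "triple_norm h \<le> 4 / 3 * \<sigma> * pair_norm (d - p)"
    proof (rule gcd.stationary_error[OF x h])
      show "gcd_product (x - h) = p"
        using t(1) z by (simp add: h_def gcd_product_orbit)
      show "triple_norm h \<le> \<sigma> * pair_norm (gcd_differential x h)"
        using near[OF x _ h] x_near \<rho>(2) t(2) by (simp add: h_def)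
      show "\<sigma> * (4 * (real k + 1)) * triple_norm h \<le> 1 / 4"
      proof -
        have "(4 * \<sigma> * \<mu>) * triple_norm h \<le> (4 * \<sigma> * \<mu>) * (1 / (4 * \<sigma> * \<mu>))"
          using t(3) \<sigma> \<mu> by (intro mult_left_mono) (auto simp: h_def)
        also have "\<dots> = 1"
          using \<sigma> \<mu> by simp
        finally show ?thesis
          by (simp add: \<mu>_def)
      qed
    qed (use it.limit_stationary[OF x lim] \<sigma> gcd_product_diff in auto)
    then have err: "triple_norm (x - gauge_orbit t z) \<le> 2 * \<kappa> * pair_norm (d - p)"
      by (simp add: h_def \<sigma>_def)
    \<comment> \<open>For exact data the error bound is zero, so the limit lies on the curve and its
      residual vanishes.\<close>
    have "quadratic_rate s x" if "d = p"
    proof -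
      have "triple_norm (x - gauge_orbit t z) \<le> 0"
        using err that by simp
      then have "x = gauge_orbit t z"
        using triple.nrm_ge_0[of "x - gauge_orbit t z"] by (metis antisym right_minus_eq triple.nrm_eq_0)
      then have "gcd_product x = d"
        using t(1) z that by (simp add: gcd_product_orbit)
      then show ?thesis
        using it.quadratic_convergence[OF x lim] by (simp add: quadratic_rate_def)
    qed
    then show "\<exists>x\<in>?V. triple_converges s x \<and>
      (\<exists>t. t \<noteq> 0 \<and> triple_norm (x - gauge_orbit t z) \<le> 2 * \<kappa> * pair_norm (d - p)) \<and>
      (d = p \<longrightarrow> quadratic_rate s x)"
      using x lim t(1) err by (auto simp: triple_converges_def)
  qed
qed

section \<open>Matrices and the Moore-Penrose inverse\<close>

lemma mat_adjoint_carrier [simp]: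
  fixes A :: "complex mat"
  shows "A \<in> carrier_mat r c \<Longrightarrow> mat_adjoint A \<in> carrier_mat c r"
  by (auto simp: mat_adjoint_def mat_of_rows_def)

lemma mat_adjoint_index [simp]:
  fixes A :: "complex mat"
  shows "i < dim_col A \<Longrightarrow> j < dim_row A \<Longrightarrow> mat_adjoint A $$ (i, j) = cnj (A $$ (j, i))"
  by (simp add: mat_adjoint_def mat_of_rows_index)

lemma mat_adjoint_dim [simp]:
  fixes A :: "complex mat"
  shows "dim_row (mat_adjoint A) = dim_col A" "dim_col (mat_adjoint A) = dim_row A"
  using mat_adjoint_carrier[of A] by blast+

lemma mat_adjoint_adjoint [simp]: "mat_adjoint (mat_adjoint A) = A"
  for A :: "complex mat"
  by (rule eq_matI) auto

lemma mat_adjoint_one [simp]: "mat_adjoint (1\<^sub>m l :: complex mat) = 1\<^sub>m l"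
  by (rule eq_matI) auto

lemma mat_adjoint_mult:
  fixes A B :: "complex mat"
  assumes "A \<in> carrier_mat a b" "B \<in> carrier_mat b c"
  shows "mat_adjoint (A * B) = mat_adjoint B * mat_adjoint A"
  by (rule eq_matI) (use assms in \<open>auto simp: scalar_prod_def mult.commute\<close>)

lemma mat_adjoint_add:
  fixes A B :: "complex mat"
  assumes "A \<in> carrier_mat a b" "B \<in> carrier_mat a b"
  shows "mat_adjoint (A + B) = mat_adjoint A + mat_adjoint B"
  by (rule eq_matI) (use assms in auto)

lemma mat_adjoint_minus:
  fixes A B :: "complex mat"
  assumes "A \<in> carrier_mat a b" "B \<in> carrier_mat a b"
  shows "mat_adjoint (A - B) = mat_adjoint A - mat_adjoint B"
  by (rule eq_matI) (use assms in auto)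

lemma mult_mat_unit_vec:
  fixes A :: "complex mat"
  assumes "A \<in> carrier_mat r c" "i < c"
  shows "A *\<^sub>v unit_vec c i = col A i"
  by (rule eq_vecI) (use assms in \<open>auto simp: scalar_prod_right_unit\<close>)

lemma mat_add_minus_cancel:
  fixes A B :: "complex mat"
  assumes "A \<in> carrier_mat r c" "B \<in> carrier_mat r c"
  shows "A + B - B = A"
  by (rule eq_matI) (use assms in auto)

lemma cscalar_prod_mult_mat_vec:
  fixes A :: "complex mat"
  assumes A: "A \<in> carrier_mat r c" and x: "x \<in> carrier_vec c" and y: "y \<in> carrier_vec r"
  shows "(A *\<^sub>v x) \<bullet>c y = x \<bullet>c (mat_adjoint A *\<^sub>v y)"
proof -
  have "(A *\<^sub>v x) \<bullet>c y = (\<Sum>i<r. (\<Sum>j<c. A $$ (i, j) * x $ j) * cnj (y $ i))"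
    using assms by (auto simp: scalar_prod_def atLeast0LessThan intro!: sum.cong)
  also have "\<dots> = (\<Sum>i<r. \<Sum>j<c. x $ j * cnj (cnj (A $$ (i, j)) * y $ i))"
    by (simp add: sum_distrib_right sum_distrib_left mult_ac)
  also have "\<dots> = (\<Sum>j<c. \<Sum>i<r. x $ j * cnj (cnj (A $$ (i, j)) * y $ i))"
    by (rule sum.swap)
  also have "\<dots> = x \<bullet>c (mat_adjoint A *\<^sub>v y)"
    using assms by (auto simp: scalar_prod_def atLeast0LessThan sum_distrib_left intro!: sum.cong)
  finally show ?thesis .
qed

lemma cscalar_prod_self: "x \<bullet>c x = of_real ((euclid_norm x)\<^sup>2)" for x :: "complex vec"
proof -
  have "x \<bullet>c x = of_real (\<Sum>i<dim_vec x. (cmod (x $ i))\<^sup>2)"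
    unfolding of_real_sum complex_norm_square by (simp add: scalar_prod_def atLeast0LessThan)
  also have "(\<Sum>i<dim_vec x. (cmod (x $ i))\<^sup>2) = (euclid_norm x)\<^sup>2"
    unfolding euclid_norm_def by (rule real_sqrt_pow2[symmetric]) (simp add: sum_nonneg)
  finally show ?thesis .
qed

text \<open>\<open>A * X\<close> and \<open>A * Y\<close> are both the orthogonal projection onto
  the range of \<open>A\<close>, and \<open>X * A\<close> and \<open>Y * A\<close> both the one onto
  the complement of its kernel. Once these agree,
  \<open>X = X * A * X = Y * A * X = Y * A * Y = Y\<close>.\<close>

lemma moore_penrose_unique:
  assumes A: "A \<in> carrier_mat r c"
    and X: "is_moore_penrose_inverse A X" and Y: "is_moore_penrose_inverse A Y"
  shows "X = Y"
proof -
  have c: "X \<in> carrier_mat c r" "Y \<in> carrier_mat c r"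
    using X Y A by (auto simp: is_moore_penrose_inverse_def)
  have x: "A * X * A = A" "X * A * X = X" "mat_adjoint (A * X) = A * X" "mat_adjoint (X * A) = X * A"
    using X by (auto simp only: is_moore_penrose_inverse_def)
  have y: "A * Y * A = A" "Y * A * Y = Y" "mat_adjoint (A * Y) = A * Y" "mat_adjoint (Y * A) = Y * A"
    using Y by (auto simp only: is_moore_penrose_inverse_def)
  have AX: "A * X \<in> carrier_mat r r" "A * Y \<in> carrier_mat r r"
    and XA: "X * A \<in> carrier_mat c c" "Y * A \<in> carrier_mat c c"
    using A c by auto
  have "A * X = (A * Y * A) * X" by (simp only: y)
  also have "\<dots> = (A * Y) * (A * X)"
    by (rule assoc_mult_mat[OF AX(2) A c(1)])
  also have "\<dots> = mat_adjoint (A * Y) * mat_adjoint (A * X)" by (simp only: x y)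
  also have "\<dots> = mat_adjoint ((A * X) * (A * Y))"
    by (rule mat_adjoint_mult[OF AX, symmetric])
  also have "(A * X) * (A * Y) = (A * X * A) * Y"
    by (rule assoc_mult_mat[OF AX(1) A c(2), symmetric])
  finally have AXY: "A * X = A * Y" by (simp only: x y)
  have "X * A = X * (A * Y * A)" by (simp only: y)
  also have "A * Y * A = A * (Y * A)"
    by (rule assoc_mult_mat[OF A c(2) A])
  also have "X * (A * (Y * A)) = (X * A) * (Y * A)"
    by (rule assoc_mult_mat[OF c(1) A XA(2), symmetric])
  also have "\<dots> = mat_adjoint (X * A) * mat_adjoint (Y * A)" by (simp only: x y)
  also have "\<dots> = mat_adjoint ((Y * A) * (X * A))"
    by (rule mat_adjoint_mult[OF XA(2,1), symmetric])
  also have "(Y * A) * (X * A) = Y * (A * (X * A))"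
    by (rule assoc_mult_mat[OF c(2) A XA(1)])
  also have "A * (X * A) = A * X * A"
    by (rule assoc_mult_mat[OF A c(1) A, symmetric])
  finally have XAY: "X * A = Y * A" by (simp only: x y)
  have "X = X * A * X" by (simp only: x)
  also have "\<dots> = Y * (A * X)"
    unfolding XAY by (rule assoc_mult_mat[OF c(2) A c(1)])
  also have "\<dots> = Y * A * Y"
    unfolding AXY by (rule assoc_mult_mat[OF c(2) A c(2), symmetric])
  finally show ?thesis by (simp only: y)
qed

lemma moore_penrose_inverse_eqI:
  assumes "A \<in> carrier_mat r c" "is_moore_penrose_inverse A X"
  shows "moore_penrose_inverse A = X"
  unfolding moore_penrose_inverse_def
  using assms moore_penrose_unique by (intro the_equality) auto

lemma invertible_matE:
  fixes A :: "'a::field mat"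
  assumes A: "A \<in> carrier_mat l l"
    and inj: "\<And>x. x \<in> carrier_vec l \<Longrightarrow> A *\<^sub>v x = 0\<^sub>v l \<Longrightarrow> x = 0\<^sub>v l"
  obtains B where "B \<in> carrier_mat l l" "B * A = 1\<^sub>m l" "A * B = 1\<^sub>m l"
proof -
  have "det A \<noteq> 0"
    using inj unfolding det_0_iff_vec_prod_zero_field[OF A] by blast
  from det_non_zero_imp_unit[OF A this, of "()"] show ?thesis
    using that by (auto simp: Units_def ring_mat_def)
qed

text \<open>When \<open>A\<close> has kernel spanned by \<open>e\<close>, the matrix \<open>G = A\<^sup>* A + e e\<^sup>*\<close> is invertible and
  \<open>G\<^sup>-\<^sup>1 A\<^sup>*\<close> satisfies the Penrose equations.\<close>

lemma moore_penrose_exists: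
  fixes A :: "complex mat"
  assumes A: "A \<in> carrier_mat r c" and e: "e \<in> carrier_vec c" "e \<noteq> 0\<^sub>v c" and Ae: "A *\<^sub>v e = 0\<^sub>v r"
    and inj: "\<And>x. x \<in> carrier_vec c \<Longrightarrow> A *\<^sub>v x = 0\<^sub>v r \<Longrightarrow> x \<bullet>c e = 0 \<Longrightarrow> x = 0\<^sub>v c"
  shows "\<exists>X. is_moore_penrose_inverse A X"
proof -
  let ?As = "mat_adjoint A"
  define E where "E = mat c c (\<lambda>(i, j). e $ i * cnj (e $ j))"
  define G where "G = ?As * A + E"
  have As: "?As \<in> carrier_mat c r" using A by simp
  have E: "E \<in> carrier_mat c c" by (simp add: E_def)
  have AsA: "?As * A \<in> carrier_mat c c" by (rule mult_carrier_mat[OF As A])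
  have G: "G \<in> carrier_mat c c" using AsA E by (simp add: G_def)
  have E_adj: "mat_adjoint E = E"
    by (rule eq_matI) (auto simp: E_def)
  have G_adj: "mat_adjoint G = G"
    unfolding G_def mat_adjoint_add[OF AsA E] mat_adjoint_mult[OF As A] by (simp add: E_adj)
  have E_vec: "E *\<^sub>v x = (x \<bullet>c e) \<cdot>\<^sub>v e" if "x \<in> carrier_vec c" for x
    by (rule eq_vecI)
       (use that e in \<open>auto simp: E_def scalar_prod_def sum_distrib_left sum_distrib_right mult_ac intro!: sum.cong\<close>)
  have AE: "A * E = 0\<^sub>m r c"
  proof (rule eq_matI)
    fix i j assume ij: "i < dim_row (0\<^sub>m r c)" "j < dim_col (0\<^sub>m r c)"
    have "(A * E) $$ (i, j) = (A *\<^sub>v e) $ i * cnj (e $ j)"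
      using ij A e by (auto simp: E_def scalar_prod_def sum_distrib_left sum_distrib_right mult_ac intro!: sum.cong)
    then show "(A * E) $$ (i, j) = 0\<^sub>m r c $$ (i, j)"
      using ij by (simp add: Ae)
  qed (use A E in auto)
  have EAs: "E * ?As = 0\<^sub>m c r"
  proof -
    have "E * ?As = mat_adjoint (A * E)"
      by (simp add: mat_adjoint_mult[OF A E] E_adj)
    then show ?thesis
      unfolding AE by (auto intro!: eq_matI)
  qed
  \<comment> \<open>As \<open>A * E\<close> and its adjoint vanish, \<open>E\<close> commutes with
    \<open>G\<close> and hence with the inverse of \<open>G\<close>; the Penrose equations involving
    \<open>X * A\<close> rest on this.\<close>
  have GE: "G * E = E * E"
    unfolding G_def add_mult_distrib_mat[OF AsA E E] assoc_mult_mat[OF As A E] AE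
      right_mult_zero_mat[OF As] left_add_zero_mat[OF mult_carrier_mat[OF E E]] ..
  have EG: "E * G = E * E"
    unfolding G_def mult_add_distrib_mat[OF E AsA E] assoc_mult_mat[OF E As A, symmetric] EAs
      left_mult_zero_mat[OF A] left_add_zero_mat[OF mult_carrier_mat[OF E E]] ..
  \<comment> \<open>Pairing \<open>G x = 0\<close> with \<open>e\<close> shows that \<open>x\<close>
    is orthogonal to \<open>e\<close>; pairing it with \<open>x\<close> then gives
    \<open>A x = 0\<close>, and \<open>inj\<close> applies.\<close>
  have "x = 0\<^sub>v c" if x: "x \<in> carrier_vec c" and Gx: "G *\<^sub>v x = 0\<^sub>v c" for x
  proof -
    have Ax: "A *\<^sub>v x \<in> carrier_vec r" using A x by simp
    have AsAx: "?As *\<^sub>v (A *\<^sub>v x) \<in> carrier_vec c" using As Ax by simp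
    have sum0: "?As *\<^sub>v (A *\<^sub>v x) + (x \<bullet>c e) \<cdot>\<^sub>v e = 0\<^sub>v c"
      using Gx unfolding G_def add_mult_distrib_mat_vec[OF AsA E x] assoc_mult_mat_vec[OF As A x] E_vec[OF x] .
    have ip: "(?As *\<^sub>v (A *\<^sub>v x)) \<bullet>c y + (x \<bullet>c e) * (e \<bullet>c y) = 0" if y: "y \<in> carrier_vec c" for y
    proof -
      have "(?As *\<^sub>v (A *\<^sub>v x) + (x \<bullet>c e) \<cdot>\<^sub>v e) \<bullet>c y = 0"
        unfolding sum0 using y by simp
      then show ?thesis
        using AsAx e y by (simp add: add_scalar_prod_distrib[of _ c])
    qed
    have adj: "(?As *\<^sub>v (A *\<^sub>v x)) \<bullet>c y = (A *\<^sub>v x) \<bullet>c (A *\<^sub>v y)" if "y \<in> carrier_vec c" for y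
      using cscalar_prod_mult_mat_vec[OF As Ax that] by simp
    have "(x \<bullet>c e) * (e \<bullet>c e) = 0"
      using ip[OF e(1)] adj[OF e(1)] Ax by (simp add: Ae)
    moreover have "e \<bullet>c e \<noteq> 0"
      using e conjugate_square_eq_0_vec[OF e(1)] by simp
    ultimately have xe: "x \<bullet>c e = 0" by simp
    then have "(A *\<^sub>v x) \<bullet>c (A *\<^sub>v x) = 0"
      using ip[OF x] adj[OF x] by simp
    then have "A *\<^sub>v x = 0\<^sub>v r"
      using conjugate_square_eq_0_vec[OF Ax] by simp
    then show ?thesis
      using inj x xe by blast
  qed
  then obtain K where K: "K \<in> carrier_mat c c" and KG: "K * G = 1\<^sub>m c" and GK: "G * K = 1\<^sub>m c"
    using invertible_matE[OF G] by blast
  have K_adj: "mat_adjoint K = K"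
  proof -
    have Ks: "mat_adjoint K \<in> carrier_mat c c" using K by simp
    have "mat_adjoint K * G = mat_adjoint (G * K)"
      by (simp add: mat_adjoint_mult[OF G K] G_adj)
    then have "mat_adjoint K * G * K = K"
      using K by (simp add: GK)
    then show ?thesis
      unfolding assoc_mult_mat[OF Ks G K] GK right_mult_one_mat[OF Ks] .
  qed
  have KE_comm: "K * E = E * K"
  proof -
    have KE: "K * E \<in> carrier_mat c c" using K E by simp
    have EK: "E * K \<in> carrier_mat c c" using K E by simp
    have "K * E = K * E * (G * K)"
      unfolding GK right_mult_one_mat[OF KE] ..
    also have "\<dots> = K * (E * G * K)"
      using K E G by (simp add: assoc_mult_mat[of _ c c _ c _ c])
    also have "E * G = G * E" by (simp only: GE EG)
    also have "K * (G * E * K) = K * G * (E * K)"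
      using K E G by (simp add: assoc_mult_mat[of _ c c _ c _ c])
    also have "\<dots> = E * K"
      unfolding KG left_mult_one_mat[OF EK] ..
    finally show ?thesis .
  qed
  define X where "X = K * ?As"
  have X: "X \<in> carrier_mat c r" using K As by (simp add: X_def)
  have KE: "K * E \<in> carrier_mat c c" using K E by simp
  \<comment> \<open>\<open>K * E\<close> is the orthogonal projection onto the span of
    \<open>e\<close>, so \<open>X * A\<close> is the projection onto its complement.\<close>
  have XA: "X * A = 1\<^sub>m c - K * E"
  proof -
    have "1\<^sub>m c = X * A + K * E"
      unfolding KG[symmetric] unfolding G_def X_def mult_add_distrib_mat[OF K AsA E]
        assoc_mult_mat[OF K As A] ..
    then show ?thesis
      using mat_add_minus_cancel[OF mult_carrier_mat[OF X A] KE] by simp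
  qed
  have "is_moore_penrose_inverse A X"
    unfolding is_moore_penrose_inverse_def
  proof (intro conjI)
    show "X \<in> carrier_mat (dim_col A) (dim_row A)" using X A by simp
    show "mat_adjoint (X * A) = X * A"
    proof -
      have KE_adj: "mat_adjoint (K * E) = K * E"
        using mat_adjoint_mult[OF K E] by (simp only: K_adj E_adj KE_comm)
      show ?thesis
        unfolding XA mat_adjoint_minus[OF one_carrier_mat KE] mat_adjoint_one KE_adj ..
    qed
    show "mat_adjoint (A * X) = A * X"
      unfolding mat_adjoint_mult[OF A X] unfolding X_def mat_adjoint_mult[OF K As]
      by (simp add: K_adj assoc_mult_mat[OF A K As])
    have "A * (K * E) = 0\<^sub>m r c"
      unfolding KE_comm assoc_mult_mat[OF A E K, symmetric] AE using K by simp
    moreover have "A * X * A = A * 1\<^sub>m c - A * (K * E)"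
      unfolding assoc_mult_mat[OF A X A] XA using mult_minus_distrib_mat[OF A one_carrier_mat KE] .
    ultimately show "A * X * A = A"
      using A by (auto intro!: eq_matI)
    have "K * E * X = K * E * K * ?As"
      unfolding X_def assoc_mult_mat[OF KE K As] ..
    also have "K * E * K = K * (K * E)"
      unfolding assoc_mult_mat[OF K E K] KE_comm[symmetric] ..
    also have "K * (K * E) * ?As = 0\<^sub>m c r"
      using K E As EAs by (simp add: assoc_mult_mat[of _ c c _ c _ c] assoc_mult_mat[of _ c c _ c _ r])
    finally show "X * A * X = X"
      unfolding XA minus_mult_distrib_mat[OF one_carrier_mat KE X] using X by (auto intro!: eq_matI)
  qed
  then show ?thesis by blast
qed

text \<open>\<open>A * X\<close> is self-adjoint and fixes the range of \<open>A\<close>. This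
  supplies the orthogonality of the linearised residual demanded of a Gauss-Newton step.\<close>

lemma moore_penrose_normal_equation:
  assumes A: "A \<in> carrier_mat r c" and X: "is_moore_penrose_inverse A X"
    and x: "x \<in> carrier_vec r" and y: "y \<in> carrier_vec c"
  shows "(A *\<^sub>v (X *\<^sub>v x)) \<bullet>c (A *\<^sub>v y) = x \<bullet>c (A *\<^sub>v y)"
proof -
  have Xc: "X \<in> carrier_mat c r" and P: "A * X * A = A" "mat_adjoint (A * X) = A * X"
    using X A by (auto simp: is_moore_penrose_inverse_def)
  have AX: "A * X \<in> carrier_mat r r" using A Xc by simp
  have Ay: "A *\<^sub>v y \<in> carrier_vec r" using A y by simp
  have "(A *\<^sub>v (X *\<^sub>v x)) \<bullet>c (A *\<^sub>v y) = x \<bullet>c ((A * X) *\<^sub>v (A *\<^sub>v y))"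
    using cscalar_prod_mult_mat_vec[OF AX x Ay] by (simp add: P assoc_mult_mat_vec[OF A Xc x])
  also have "(A * X) *\<^sub>v (A *\<^sub>v y) = A *\<^sub>v y"
    using assoc_mult_mat_vec[OF AX A y] by (simp add: P)
  finally show ?thesis .
qed

text \<open>Since \<open>X = X * A * X\<close>, the self-adjoint matrix \<open>X * A\<close> fixes
  the range of \<open>X\<close>, and it annihilates the kernel of \<open>A\<close>.\<close>

lemma moore_penrose_orthogonal_kernel:
  assumes A: "A \<in> carrier_mat r c" and X: "is_moore_penrose_inverse A X"
    and x: "x \<in> carrier_vec r" and e: "e \<in> carrier_vec c" "A *\<^sub>v e = 0\<^sub>v r"
  shows "(X *\<^sub>v x) \<bullet>c e = 0"
proof -
  have Xc: "X \<in> carrier_mat c r" and P: "X * A * X = X" "mat_adjoint (X * A) = X * A"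
    using X A by (auto simp: is_moore_penrose_inverse_def)
  have XA: "X * A \<in> carrier_mat c c" using A Xc by simp
  have Xx: "X *\<^sub>v x \<in> carrier_vec c" using Xc x by simp
  have "(X *\<^sub>v x) = (X * A) *\<^sub>v (X *\<^sub>v x)"
    using assoc_mult_mat_vec[OF XA Xc x] by (simp add: P)
  then have "(X *\<^sub>v x) \<bullet>c e = (X *\<^sub>v x) \<bullet>c ((X * A) *\<^sub>v e)"
    using cscalar_prod_mult_mat_vec[OF XA Xx e(1)] by (simp add: P)
  also have "(X * A) *\<^sub>v e = 0\<^sub>v c"
    unfolding assoc_mult_mat_vec[OF Xc A e(1)] e(2) using Xc by auto
  finally show ?thesis
    using Xx by simp
qed

text \<open>Pick an index \<open>l\<close> where \<open>e\<close> does not vanish and drop that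
  column. A kernel vector vanishing at \<open>l\<close> is a multiple of \<open>e\<close>, hence
  zero, so the other \<open>c - 1\<close> columns are independent; full rank is impossible because
  \<open>A\<close> annihilates \<open>e\<close>.\<close>

lemma rank_one_dim_kernel:
  fixes A :: "complex mat"
  assumes A: "A \<in> carrier_mat r c" and e: "e \<in> carrier_vec c" "e \<noteq> 0\<^sub>v c" and Ae: "A *\<^sub>v e = 0\<^sub>v r"
    and inj: "\<And>x. x \<in> carrier_vec c \<Longrightarrow> A *\<^sub>v x = 0\<^sub>v r \<Longrightarrow> x \<bullet>c e = 0 \<Longrightarrow> x = 0\<^sub>v c"
  shows "vec_space.rank r A = c - 1"
proof -
  interpret vec_space "TYPE(complex)" r .
  obtain l where l: "l < c" "e $ l \<noteq> 0"
    using e by (metis eq_vecI carrier_vecD index_zero_vec)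
  define js where "js = filter (\<lambda>j. j \<noteq> l) [0..<c]"
  define B where "B = mat_of_cols r (map (col A) js)"
  have len: "length js = c - 1"
  proof -
    have "length js = card ({0..<c} - {l})"
      unfolding js_def distinct_length_filter[OF distinct_upt] by (rule arg_cong[where f = card]) auto
    then show ?thesis using l by simp
  qed
  have js: "distinct js" "set js = {..<c} - {l}"
    by (auto simp: js_def)
  have B: "B \<in> carrier_mat r (c - 1)"
    using mat_of_cols_carrier(1)[of r "map (col A) js"] by (simp only: B_def len length_map)
  have cols_B: "cols B = map (col A) js"
    unfolding B_def using A by (intro cols_mat_of_cols) auto
  have kernel: "x = 0\<^sub>v c" if x: "x \<in> carrier_vec c" "A *\<^sub>v x = 0\<^sub>v r" "x $ l = 0" for x
  proof -
    define a where "a = (x \<bullet>c e) / (e \<bullet>c e)"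
    have ee: "e \<bullet>c e \<noteq> 0"
      using e conjugate_square_eq_0_vec[OF e(1)] by simp
    have ae: "a \<cdot>\<^sub>v e \<in> carrier_vec c" using e by simp
    have "A *\<^sub>v (x - a \<cdot>\<^sub>v e) = 0\<^sub>v r"
      using mult_minus_distrib_mat_vec[OF A x(1) ae] mult_mat_vec[OF A e(1), of a] x(2) Ae by simp
    moreover have "(x - a \<cdot>\<^sub>v e) \<bullet>c e = 0"
      using minus_scalar_prod_distrib[OF x(1) ae, of "conjugate e"] e ee by (simp add: a_def)
    ultimately have 0: "x - a \<cdot>\<^sub>v e = 0\<^sub>v c"
      using inj x ae by simp
    have xa: "x $ i = a * e $ i" if "i < c" for i
    proof -
      have "(x - a \<cdot>\<^sub>v e) $ i = 0"
        unfolding 0 using that by simp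
      then show ?thesis
        using that e by simp
    qed
    then have "a = 0" using l x(3) by simp
    then show ?thesis
      using xa x(1) by (auto intro!: eq_vecI)
  qed
  have B_kernel: "y = 0\<^sub>v (c - 1)" if y: "y \<in> carrier_vec (c - 1)" "B *\<^sub>v y = 0\<^sub>v r" for y
  proof -
    \<comment> \<open>\<open>pos\<close> inverts the enumeration \<open>js\<close>; with it a vector
      for \<open>B\<close> is padded by a zero at \<open>l\<close> to a vector for
      \<open>A\<close>.\<close>
    define pos where "pos j = (THE i. i < c - 1 \<and> js ! i = j)" for j
    have pos: "pos (js ! i) = i" if "i < c - 1" for i
      unfolding pos_def using that js(1) len by (auto simp: nth_eq_iff_index_eq intro!: the_equality)
    define x where "x = vec c (\<lambda>j. if j = l then 0 else y $ pos j)"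
    have x: "x \<in> carrier_vec c" by (simp add: x_def)
    have "A *\<^sub>v x = B *\<^sub>v y"
    proof (rule eq_vecI)
      fix i assume "i < dim_vec (B *\<^sub>v y)"
      then have i: "i < r" using B by simp
      have "(A *\<^sub>v x) $ i = (\<Sum>j<c. A $$ (i, j) * x $ j)"
        using i A by (auto simp: scalar_prod_def x_def atLeast0LessThan intro!: sum.cong)
      also have "\<dots> = (\<Sum>j\<in>set js. A $$ (i, j) * x $ j)"
        by (rule sum.mono_neutral_right) (use l in \<open>auto simp: js x_def\<close>)
      also have "\<dots> = (\<Sum>t<c - 1. A $$ (i, js ! t) * x $ (js ! t))"
        using sum.reindex_bij_betw[OF bij_betw_nth[OF js(1) refl refl], of "\<lambda>j. A $$ (i, j) * x $ j"]
        by (simp add: len)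
      also have "\<dots> = (\<Sum>t<c - 1. B $$ (i, t) * y $ t)"
      proof (rule sum.cong[OF refl])
        fix t assume "t \<in> {..<c - 1}"
        then have t: "t < c - 1" "js ! t < c" "js ! t \<noteq> l"
          using js(2) len nth_mem[of t js] by auto
        then show "A $$ (i, js ! t) * x $ (js ! t) = B $$ (i, t) * y $ t"
          using i A by (simp add: x_def pos B_def mat_of_cols_index len)
      qed
      also have "\<dots> = (B *\<^sub>v y) $ i"
        using i B y(1) by (auto simp: scalar_prod_def atLeast0LessThan intro!: sum.cong)
      finally show "(A *\<^sub>v x) $ i = (B *\<^sub>v y) $ i" .
    qed (use A B in auto)
    then have "x = 0\<^sub>v c"
      using kernel[OF x] y(2) l by (simp add: x_def)
    have "y $ i = 0" if "i < c - 1" for i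
    proof -
      have "js ! i \<in> set js"
        using that len by simp
      then have "x $ (js ! i) = y $ i" "js ! i < c"
        using pos[OF that] js(2) by (auto simp: x_def)
      with \<open>x = 0\<^sub>v c\<close> show ?thesis
        by simp
    qed
    then show ?thesis
      using y(1) by (auto intro!: eq_vecI)
  qed
  \<comment> \<open>Independence concerns the set of columns, so repetitions must be excluded
    separately: two equal columns would put a difference of unit vectors into the kernel.\<close>
  have "distinct (cols B)"
  proof (rule ccontr)
    assume "\<not> distinct (cols B)"
    then obtain i j where ij: "i < c - 1" "j < c - 1" "i \<noteq> j" "col B i = col B j"
      using B by (auto simp: distinct_conv_nth)
    define y :: "complex vec" where "y = unit_vec (c - 1) i - unit_vec (c - 1) j"
    have "B *\<^sub>v y = col B i - col B j"
      unfolding y_def mult_minus_distrib_mat_vec[OF B unit_vec_carrier unit_vec_carrier]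
        mult_mat_unit_vec[OF B ij(1)] mult_mat_unit_vec[OF B ij(2)] ..
    also have "\<dots> = 0\<^sub>v r"
      using B ij by auto
    finally have "y = 0\<^sub>v (c - 1)"
      by (intro B_kernel) (auto simp: y_def)
    then have "y $ i = 0" using ij by simp
    then show False using ij by (simp add: y_def)
  qed
  moreover have "lin_indpt (set (cols B))"
    using lin_depE[OF B _ \<open>distinct (cols B)\<close>] B_kernel by blast
  moreover have "set (cols B) \<subseteq> set (cols A)"
    unfolding cols_B set_map js(2) using A by (auto simp: cols_def)
  ultimately have "c - 1 \<le> rank A"
    using rank_ge_card_indpt[OF A, of "set (cols B)"] distinct_card[of "cols B"] B by simp
  \<comment> \<open>With repeated columns fewer than \<open>c\<close> vectors are available; with
    distinct columns full rank would make them independent, against \<open>A e = 0\<close>.\<close>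
  moreover have "rank A \<noteq> c"
  proof
    assume full: "rank A = c"
    have "distinct (cols A)"
    proof (rule ccontr)
      assume "\<not> distinct (cols A)"
      then have "card (set (cols A)) < c"
        using A card_length[of "cols A"] card_distinct[of "cols A"] by fastforce
      moreover obtain S where S: "maximal S (\<lambda>T. T \<subseteq> set (cols A) \<and> lin_indpt T)"
        using maximal_exists[of "(\<lambda>T. T \<subseteq> set (cols A) \<and> lin_indpt T)" "card (set (cols A))" "{}"]
        by (meson List.finite_set card_mono empty_iff empty_subsetI finite_lin_indpt2 rev_finite_subset)
      moreover have "card S \<le> card (set (cols A))"
        using S by (simp add: card_mono maximal_def)
      ultimately show False
        using rank_card_indpt[OF A S] full by simp
    qed
    then show False
      using lin_depI[OF A e Ae] full_rank_lin_indpt[OF A full] by blast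
  qed
  ultimately show ?thesis
    using rank_le_nc[OF A] by simp
qed

section \<open>Rank projections and the operator norm\<close>

lemma frobenius_norm_eq_0:
  assumes "frobenius_norm A \<le> 0"
  shows "A = 0\<^sub>m (dim_row A) (dim_col A)"
proof (rule eq_matI)
  fix i j assume ij: "i < dim_row (0\<^sub>m (dim_row A) (dim_col A))" "j < dim_col (0\<^sub>m (dim_row A) (dim_col A))"
  have "(\<Sum>i<dim_row A. \<Sum>j<dim_col A. (cmod (A $$ (i, j)))\<^sup>2) \<le> 0"
    using assms by (simp add: frobenius_norm_def)
  then have 0: "(\<Sum>i<dim_row A. \<Sum>j<dim_col A. (cmod (A $$ (i, j)))\<^sup>2) = 0"
    by (rule antisym) (intro sum_nonneg zero_le_power2)
  have "(\<Sum>j<dim_col A. (cmod (A $$ (i, j)))\<^sup>2) = 0"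
    using 0 ij by (subst (asm) sum_nonneg_eq_0_iff) (auto intro!: sum_nonneg)
  then have "(cmod (A $$ (i, j)))\<^sup>2 = 0"
    using ij by (subst (asm) sum_nonneg_eq_0_iff) auto
  then show "A $$ (i, j) = 0\<^sub>m (dim_row A) (dim_col A) $$ (i, j)"
    using ij by simp
qed auto

text \<open>A matrix of the right rank has distance zero from itself, so a minimiser must have
  distance zero too. This settles the choice made in \<open>rank_projection\<close>.\<close>

lemma is_rank_projection_self:
  assumes "vec_space.rank (dim_row A) A = r"
  shows "is_rank_projection r A B \<longleftrightarrow> B = A"
proof
  have self: "frobenius_norm (A - A) = 0"
    by (simp add: frobenius_norm_def)
  have nonneg: "0 \<le> frobenius_norm C" for C
    by (auto simp: frobenius_norm_def intro!: sum_nonneg)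
  show "B = A" if "is_rank_projection r A B"
  proof -
    have B: "B \<in> carrier_mat (dim_row A) (dim_col A)" "\<not> frobenius_norm (A - A) < frobenius_norm (A - B)"
      using that assms unfolding is_rank_projection_def is_arg_min_def by auto
    then have "A - B = 0\<^sub>m (dim_row A) (dim_col A)"
      using frobenius_norm_eq_0[of "A - B"] self by simp
    then have "(A - B) $$ (i, j) = 0" if "i < dim_row A" "j < dim_col A" for i j
      using that by simp
    then show ?thesis
      using B(1) by (auto intro!: eq_matI)
  qed
  show "is_rank_projection r A B" if "B = A"
    using that assms nonneg unfolding is_rank_projection_def is_arg_min_def self by (auto simp: self not_less)
qed

lemma rank_pinv_self:
  assumes "A \<in> carrier_mat a b" "vec_space.rank a A = r" "is_moore_penrose_inverse A X"
  shows "rank_pinv r A = X"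
proof -
  have "rank_projection r A = A"
    using is_rank_projection_self[of A r] assms by (simp add: rank_projection_def)
  then show ?thesis
    using assms by (simp add: rank_pinv_def moore_penrose_inverse_eqI)
qed

lemma cmod_index_le_euclid_norm: "i < dim_vec x \<Longrightarrow> cmod (x $ i) \<le> euclid_norm x"
  unfolding euclid_norm_def
  by (rule real_le_rsqrt) (rule member_le_sum, auto)

lemma euclid_norm_smult: "euclid_norm (a \<cdot>\<^sub>v x) = cmod a * euclid_norm x"
  by (simp add: euclid_norm_def norm_mult power_mult_distrib real_sqrt_mult flip: sum_distrib_left)

lemma euclid_norm_eq_0: "euclid_norm x = 0 \<Longrightarrow> x = 0\<^sub>v (dim_vec x)"
  using cmod_index_le_euclid_norm[of _ x] by (auto intro!: eq_vecI)

lemma euclid_norm_nonneg: "0 \<le> euclid_norm x"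
  by (auto simp: euclid_norm_def intro!: sum_nonneg)

lemma euclid_norm_mult_le_op_norm:
  assumes A: "A \<in> carrier_mat r c" and x: "x \<in> carrier_vec c"
  shows "euclid_norm (A *\<^sub>v x) \<le> op_norm A * euclid_norm x"
proof -
  let ?S = "{x \<in> carrier_vec c. euclid_norm x \<le> 1}"
  \<comment> \<open>The supremum in \<open>op_norm\<close> dominates its members only if the set is
    bounded; the sum of the moduli of the entries is a crude bound.\<close>
  have "euclid_norm (A *\<^sub>v y) \<le> (\<Sum>i<r. \<Sum>j<c. cmod (A $$ (i, j)))" if y: "y \<in> ?S" for y
  proof -
    have "euclid_norm (A *\<^sub>v y) \<le> (\<Sum>i<r. cmod ((A *\<^sub>v y) $ i))"
      using L2_set_le_sum[of "{..<r}" "\<lambda>i. cmod ((A *\<^sub>v y) $ i)"] A by (simp add: euclid_norm_def L2_set_def)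
    also have "\<dots> \<le> (\<Sum>i<r. \<Sum>j<c. cmod (A $$ (i, j)))"
    proof (rule sum_mono)
      fix i assume "i \<in> {..<r}"
      then have "cmod ((A *\<^sub>v y) $ i) = cmod (\<Sum>j<c. A $$ (i, j) * y $ j)"
        using A y by (auto simp: scalar_prod_def atLeast0LessThan intro!: arg_cong[where f = cmod] sum.cong)
      also have "\<dots> \<le> (\<Sum>j<c. cmod (A $$ (i, j)) * 1)"
        using y order_trans[OF cmod_index_le_euclid_norm[of _ y], of _ 1]
        by (intro sum_norm_le) (auto simp: norm_mult intro!: mult_left_le)
      finally show "cmod ((A *\<^sub>v y) $ i) \<le> (\<Sum>j<c. cmod (A $$ (i, j)))" by simp
    qed
    finally show ?thesis .
  qed
  then have bdd: "bdd_above ((\<lambda>x. euclid_norm (A *\<^sub>v x)) ` ?S)"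
    by (intro bdd_aboveI) auto
  have upper: "euclid_norm (A *\<^sub>v y) \<le> op_norm A" if "y \<in> ?S" for y
    unfolding op_norm_def using A cSUP_upper[OF that bdd] by simp
  show ?thesis
  proof (cases "euclid_norm x = 0")
    case True
    then have "x = 0\<^sub>v c" using euclid_norm_eq_0[of x] x by simp
    then show ?thesis
      using A True by (simp add: euclid_norm_def)
  next
    case False
    define a where "a = 1 / euclid_norm x"
    have a: "0 < a" "a * euclid_norm x = 1"
      using False euclid_norm_nonneg[of x] by (auto simp: a_def)
    have "euclid_norm (A *\<^sub>v (of_real a \<cdot>\<^sub>v x)) \<le> op_norm A"
      using x a by (intro upper) (simp add: euclid_norm_smult)
    then have "a * euclid_norm (A *\<^sub>v x) \<le> op_norm A"
      using a by (simp add: mult_mat_vec[OF A x] euclid_norm_smult)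
    then show ?thesis
      using a(1) by (simp add: a_def field_simps split: if_splits)
  qed
qed

section \<open>Coordinates and the Jacobian matrix\<close>

lemma coeff_vec_poly: "coeff (vec_poly x) i = (if i < dim_vec x then x $ i else 0)"
proof -
  have "coeff (vec_poly x) i = (\<Sum>j<dim_vec x. if j = i then x $ j else 0)"
    unfolding vec_poly_def coeff_sum coeff_monom ..
  also have "\<dots> = (if i < dim_vec x then x $ i else 0)"
    by (simp only: sum.delta finite_lessThan lessThan_iff)
  finally show ?thesis .
qed

lemma degree_vec_poly: "dim_vec x = l + 1 \<Longrightarrow> degree (vec_poly x) \<le> l"
  by (rule degree_le) (simp add: coeff_vec_poly)

lemma triple_vec_carrier [simp]: "triple_vec k m n z \<in> carrier_vec ((k + 1) + (m - k + 1) + (n - k + 1))"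
  by (cases z) (auto simp: coeff_vec_def intro!: carrier_vecI)

lemma pair_vec_carrier [simp]: "pair_vec m n d \<in> carrier_vec ((m + 1) + (n + 1))"
  by (cases d) (auto simp: coeff_vec_def intro!: carrier_vecI)

lemma triple_vec_index:
  "i < (k + 1) + (m - k + 1) + (n - k + 1) \<Longrightarrow> triple_vec k m n z $ i =
    (if i < k + 1 then coeff (fst z) i
     else if i < (k + 1) + (m - k + 1) then coeff (fst (snd z)) (i - (k + 1))
     else coeff (snd (snd z)) (i - (k + 1) - (m - k + 1)))"
  by (cases z) (auto simp: coeff_vec_def)

lemma pair_vec_index:
  "i < (m + 1) + (n + 1) \<Longrightarrow> pair_vec m n d $ i =
    (if i < m + 1 then coeff (fst d) i else coeff (snd d) (i - (m + 1)))"
  by (cases d) (auto simp: coeff_vec_def)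

lemma vec_triple_mem: "vec_triple k m n x \<in> triple_space k m n"
  by (auto simp: vec_triple_def triple_space_def poly_space_def intro!: degree_vec_poly)

lemma triple_vec_vec_triple:
  assumes "x \<in> carrier_vec ((k + 1) + (m - k + 1) + (n - k + 1))"
  shows "triple_vec k m n (vec_triple k m n x) = x"
proof (rule eq_vecI)
  fix i assume "i < dim_vec x"
  then have "i < (k + 1) + (m - k + 1) + (n - k + 1)"
    using assms by simp
  then consider "i < k + 1"
    | j where "i = (k + 1) + j" "j < m - k + 1"
    | j where "i = (k + 1) + (m - k + 1) + j" "j < n - k + 1"
    by (metis add_less_cancel_left le_Suc_ex not_less add.assoc)
  then show "triple_vec k m n (vec_triple k m n x) $ i = x $ i"
    by cases ((subst triple_vec_index; simp add: vec_triple_def coeff_vec_poly)+)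
qed (simp only: carrier_vecD[OF assms] carrier_vecD[OF triple_vec_carrier])

lemma vec_triple_triple_vec:
  assumes "z \<in> triple_space k m n"
  shows "vec_triple k m n (triple_vec k m n z) = z"
proof -
  have deg: "degree (fst z) \<le> k" "degree (fst (snd z)) \<le> m - k" "degree (snd (snd z)) \<le> n - k"
    using assms by (auto simp: triple_space_def poly_space_def)
  have "vec_poly (vec (k + 1) (\<lambda>i. triple_vec k m n z $ i)) = fst z"
    by (rule poly_eqI) (use deg in \<open>auto simp: coeff_vec_poly triple_vec_index coeff_eq_0\<close>)
  moreover have "vec_poly (vec (m - k + 1) (\<lambda>i. triple_vec k m n z $ (k + 1 + i))) = fst (snd z)"
    by (rule poly_eqI) (use deg in \<open>auto simp: coeff_vec_poly triple_vec_index coeff_eq_0\<close>)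
  moreover have "vec_poly (vec (n - k + 1) (\<lambda>i. triple_vec k m n z $ (k + 1 + (m - k + 1) + i))) = snd (snd z)"
    by (rule poly_eqI) (use deg in \<open>auto simp: coeff_vec_poly triple_vec_index coeff_eq_0\<close>)
  ultimately show ?thesis
    by (simp add: vec_triple_def)
qed

lemma vec_triple_add_smult:
  assumes "x \<in> carrier_vec ((k + 1) + (m - k + 1) + (n - k + 1))"
    "y \<in> carrier_vec ((k + 1) + (m - k + 1) + (n - k + 1))"
  shows "vec_triple k m n (x + t \<cdot>\<^sub>v y) = vec_triple k m n x + triple_smult t (vec_triple k m n y)"
  using assms by (auto simp: vec_triple_def poly_eq_iff coeff_vec_poly)

text \<open>The entry \<open>i\<close> of \<open>pair_vec m n d\<close> as a total function, so that
  linearity can be stated without index bounds.\<close>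

definition pair_coord :: "nat \<Rightarrow> nat \<Rightarrow> poly_pair \<Rightarrow> complex" where
  "pair_coord m i d = (if i < m + 1 then coeff (fst d) i else coeff (snd d) (i - (m + 1)))"

lemma gcd_differential_add_smult:
  "pair_coord m i (gcd_differential z (x + triple_smult t y))
    = pair_coord m i (gcd_differential z x) + t * pair_coord m i (gcd_differential z y)"
  by (cases x; cases y; cases z) (auto simp: pair_coord_def algebra_simps)

lemma gcd_jacobian_carrier [simp]:
  "gcd_jacobian k m n z d \<in> carrier_mat ((m + 1) + (n + 1)) ((k + 1) + (m - k + 1) + (n - k + 1))"
  by (simp add: gcd_jacobian_def jacobian_matrix_def)

text \<open>Along a coordinate line every entry is a polynomial of degree at most two in
  \<open>t\<close>; its linear coefficient is the value of the differential, and the derivative at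
  zero picks it out.\<close>

lemma gcd_jacobian_index:
  assumes z: "z \<in> triple_space k m n" and i: "i < (m + 1) + (n + 1)"
    and j: "j < (k + 1) + (m - k + 1) + (n - k + 1)"
  shows "gcd_jacobian k m n z d $$ (i, j) = pair_coord m i
    (gcd_differential z (vec_triple k m n (unit_vec ((k + 1) + (m - k + 1) + (n - k + 1)) j)))"
proof -
  define E where "E = vec_triple k m n (unit_vec ((k + 1) + (m - k + 1) + (n - k + 1)) j)"
  have "pair_vec m n (gcd_map (vec_triple k m n (triple_vec k m n z
        + t \<cdot>\<^sub>v unit_vec ((k + 1) + (m - k + 1) + (n - k + 1)) j)) d) $ i
      = (pair_coord m i (gcd_map z d) + t * pair_coord m i (gcd_differential z E))
        + t\<^sup>2 * pair_coord m i (gcd_product E)" for t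
  proof -
    have "vec_triple k m n (triple_vec k m n z + t \<cdot>\<^sub>v unit_vec ((k + 1) + (m - k + 1) + (n - k + 1)) j)
        = z + triple_smult t E"
      unfolding E_def vec_triple_add_smult[OF triple_vec_carrier unit_vec_carrier]
        vec_triple_triple_vec[OF z] ..
    moreover have "pair_coord m i (gcd_map (z + triple_smult t E) d)
      = (pair_coord m i (gcd_map z d) + t * pair_coord m i (gcd_differential z E))
        + t\<^sup>2 * pair_coord m i (gcd_product E)"
      by (cases z; cases E; cases d) (auto simp: pair_coord_def algebra_simps power2_eq_square)
    ultimately show ?thesis
      using i by (simp add: pair_vec_index pair_coord_def)
  qed
  moreover have "((\<lambda>t. (a + t * b) + t\<^sup>2 * c) has_field_derivative b) (at 0)" for a b c :: complex
    by (auto intro!: derivative_eq_intros)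
  ultimately show ?thesis
    using i j by (simp add: gcd_jacobian_def jacobian_matrix_def E_def DERIV_imp_deriv)
qed

lemma vec_prefix_Suc:
  fixes x :: "complex vec"
  assumes "l < N"
  shows "vec N (\<lambda>j. if j < Suc l then x $ j else 0)
    = vec N (\<lambda>j. if j < l then x $ j else 0) + x $ l \<cdot>\<^sub>v unit_vec N l"
  by (rule eq_vecI) (use assms in \<open>auto simp: less_Suc_eq\<close>)

lemma vec_eq_if_diff_eq_0:
  fixes x y :: "complex vec"
  assumes "x \<in> carrier_vec N" "y \<in> carrier_vec N" "x - y = 0\<^sub>v N"
  shows "x = y"
proof (rule eq_vecI)
  fix i assume "i < dim_vec y"
  then have i: "i < N" using assms(2) by simp
  have "(x - y) $ i = 0" unfolding assms(3) using i by simp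
  then show "x $ i = y $ i" using i assms(2) by simp
qed (use assms in simp)

text \<open>The entries describe the differential on unit vectors only; linearity extends this to
  \<open>x\<close> by induction over its truncations \<open>part l\<close>.\<close>

lemma gcd_jacobian_mult:
  assumes z: "z \<in> triple_space k m n" and x: "x \<in> carrier_vec ((k + 1) + (m - k + 1) + (n - k + 1))"
  shows "gcd_jacobian k m n z d *\<^sub>v x = pair_vec m n (gcd_differential z (vec_triple k m n x))"
proof (rule eq_vecI)
  define N where "N = (k + 1) + (m - k + 1) + (n - k + 1)"
  define part where "part l = vec N (\<lambda>j. if j < l then x $ j else 0)" for l
  define D where "D y i = pair_coord m i (gcd_differential z (vec_triple k m n y))" for y i
  fix i assume "i < dim_vec (pair_vec m n (gcd_differential z (vec_triple k m n x)))"
  then have i: "i < (m + 1) + (n + 1)"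
    by (simp only: carrier_vecD[OF pair_vec_carrier])
  have D_part: "D (part l) i = (\<Sum>j<l. D (unit_vec N j) i * x $ j)" if "l \<le> N" for l
    using that
  proof (induction l)
    case 0
    have "vec_triple k m n (part 0) = (0, 0, 0)"
      by (auto simp: vec_triple_def part_def N_def poly_eq_iff coeff_vec_poly)
    then show ?case
      by (cases z) (simp add: D_def pair_coord_def)
  next
    case (Suc l)
    have "part (Suc l) = part l + x $ l \<cdot>\<^sub>v unit_vec N l"
      unfolding part_def using Suc.prems by (intro vec_prefix_Suc) simp
    moreover have "part l \<in> carrier_vec ((k + 1) + (m - k + 1) + (n - k + 1))"
      by (simp add: part_def N_def)
    ultimately have "D (part (Suc l)) i = D (part l) i + x $ l * D (unit_vec N l) i"
      unfolding D_def N_def using vec_triple_add_smult[OF _ unit_vec_carrier]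
        gcd_differential_add_smult by metis
    then show ?case
      using Suc by (simp add: mult.commute)
  qed
  have "(gcd_jacobian k m n z d *\<^sub>v x) $ i = row (gcd_jacobian k m n z d) i \<bullet> x"
    using i carrier_matD[OF gcd_jacobian_carrier[of k m n z d]] by simp
  also have "\<dots> = (\<Sum>j<N. gcd_jacobian k m n z d $$ (i, j) * x $ j)"
    unfolding scalar_prod_def atLeast0LessThan carrier_vecD[OF x] N_def[symmetric]
    using i carrier_matD[OF gcd_jacobian_carrier[of k m n z d]]
    by (intro sum.cong) (auto simp: N_def)
  also have "\<dots> = (\<Sum>j<N. D (unit_vec N j) i * x $ j)"
    unfolding D_def N_def using gcd_jacobian_index[OF z i] by (intro sum.cong) auto
  also have "\<dots> = D (part N) i"
    using D_part by simp
  also have "part N = x"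
    by (rule eq_vecI) (use x in \<open>auto simp: part_def N_def\<close>)
  also have "D x i = pair_vec m n (gcd_differential z (vec_triple k m n x)) $ i"
    unfolding D_def pair_vec_index[OF i] pair_coord_def ..
  finally show "(gcd_jacobian k m n z d *\<^sub>v x) $ i
      = pair_vec m n (gcd_differential z (vec_triple k m n x)) $ i" .
qed (simp only: dim_mult_mat_vec carrier_matD[OF gcd_jacobian_carrier] carrier_vecD[OF pair_vec_carrier])

section \<open>The coordinate maps as isometries\<close>

definition pair_cinner :: "poly_pair \<Rightarrow> poly_pair \<Rightarrow> complex" where
  "pair_cinner x y = poly_cinner (fst x) (fst y) + poly_cinner (snd x) (snd y)"

lemma pair_inner_eq_Re: "pair_inner x y = Re (pair_cinner x y)"
  by (simp add: pair_inner_def poly_inner_def pair_cinner_def)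

lemma cscalar_prod_coeff_vec:
  "degree f \<le> l \<Longrightarrow> coeff_vec l f \<bullet>c coeff_vec l g = poly_cinner f g"
  by (simp add: poly_cinner_eq_sum scalar_prod_def coeff_vec_def atLeast0LessThan lessThan_Suc_atMost)

lemma cscalar_prod_append:
  fixes x y a b :: "complex vec"
  assumes "dim_vec x = dim_vec a" "dim_vec y = dim_vec b"
  shows "(x @\<^sub>v y) \<bullet>c (a @\<^sub>v b) = x \<bullet>c a + y \<bullet>c b"
proof -
  have "conjugate (a @\<^sub>v b) = conjugate a @\<^sub>v conjugate b"
    by (rule eq_vecI) auto
  moreover have "(x @\<^sub>v y) \<bullet> (conjugate a @\<^sub>v conjugate b) = x \<bullet>c a + y \<bullet>c b"
    by (rule scalar_prod_append[of _ "dim_vec x" _ "dim_vec y"]) (use assms in \<open>auto intro!: carrier_vecI\<close>)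
  ultimately show ?thesis by simp
qed

lemma dim_coeff_vec [simp]: "dim_vec (coeff_vec l f) = l + 1"
  by (simp add: coeff_vec_def)

lemma cscalar_prod_triple_vec:
  "x \<in> triple_space k m n \<Longrightarrow> triple_vec k m n x \<bullet>c triple_vec k m n y = triple_cinner x y"
  by (cases x; cases y) (auto simp: cscalar_prod_append cscalar_prod_coeff_vec triple_cinner_def
      triple_space_def poly_space_def)

lemma cscalar_prod_pair_vec:
  "x \<in> pair_space m n \<Longrightarrow> pair_vec m n x \<bullet>c pair_vec m n y = pair_cinner x y"
  by (cases x; cases y) (auto simp: cscalar_prod_append cscalar_prod_coeff_vec pair_cinner_def
      pair_space_def poly_space_def)

lemma euclid_norm_triple_vec:
  assumes "x \<in> triple_space k m n"
  shows "euclid_norm (triple_vec k m n x) = triple_norm x"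
proof -
  have "complex_of_real ((euclid_norm (triple_vec k m n x))\<^sup>2) = of_real ((triple_norm x)\<^sup>2)"
    using cscalar_prod_triple_vec[OF assms, of x] by (simp only: cscalar_prod_self triple_cinner_self)
  then show ?thesis
    using euclid_norm_nonneg triple.nrm_ge_0 by (simp only: of_real_eq_iff power2_eq_iff_nonneg)
qed

lemma euclid_norm_pair_vec:
  assumes "x \<in> pair_space m n"
  shows "euclid_norm (pair_vec m n x) = pair_norm x"
proof -
  have "complex_of_real ((euclid_norm (pair_vec m n x))\<^sup>2) = pair_cinner x x"
    using cscalar_prod_pair_vec[OF assms, of x] by (simp only: cscalar_prod_self)
  then have "(euclid_norm (pair_vec m n x))\<^sup>2 = (pair_norm x)\<^sup>2"
    unfolding pair.nrm_power2 pair_inner_eq_Re by (metis Re_complex_of_real)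
  then show ?thesis
    using euclid_norm_nonneg pair.nrm_ge_0 by (simp only: power2_eq_iff_nonneg)
qed

lemma gcd_differential_mem:
  assumes "z \<in> triple_space k m n" "h \<in> triple_space k m n" "k \<le> m" "k \<le> n"
  shows "gcd_differential z h \<in> pair_space m n"
proof -
  have "degree (f * g) \<le> l" if "degree f \<le> k" "degree g \<le> l - k" "k \<le> l" for f g :: "complex poly" and l
    using degree_mult_le[of f g] that by linarith
  then show ?thesis
    using assms by (cases z; cases h) (auto simp: triple_space_def pair_space_def poly_space_def intro!: degree_add_le)
qed

lemma gcd_product_mem:
  assumes "z \<in> triple_space k m n" "k \<le> m" "k \<le> n"
  shows "gcd_product z \<in> pair_space m n"
proof -
  have "degree (f * g) \<le> l" if "degree f \<le> k" "degree g \<le> l - k" "k \<le> l" for f g :: "complex poly" and l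
    using degree_mult_le[of f g] that by linarith
  then show ?thesis
    using assms by (cases z) (auto simp: triple_space_def pair_space_def poly_space_def)
qed

text \<open>The common setting for the exact zero and for nearby iterates: \<open>regular\<close>
  says that the kernel of the differential meets the complement of the tangent only in zero.\<close>

context
  fixes k m n :: nat and y :: poly_triple
  assumes km: "k \<le> m" and kn: "k \<le> n" and y: "y \<in> triple_space k m n" "y \<noteq> 0"
    and regular: "\<And>h. h \<in> triple_space k m n \<Longrightarrow> triple_cinner h (gauge_tangent y) = 0 \<Longrightarrow>
      gcd_differential y h = 0 \<Longrightarrow> h = 0"
begin

lemma jacobian_kernel:
  assumes x: "x \<in> carrier_vec ((k + 1) + (m - k + 1) + (n - k + 1))"
    and Ax: "gcd_jacobian k m n y d *\<^sub>v x = 0\<^sub>v ((m + 1) + (n + 1))"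
    and xe: "x \<bullet>c triple_vec k m n (gauge_tangent y) = 0"
  shows "x = 0\<^sub>v ((k + 1) + (m - k + 1) + (n - k + 1))"
proof -
  define h where "h = vec_triple k m n x"
  have h: "h \<in> triple_space k m n" by (simp add: h_def vec_triple_mem)
  have xh: "triple_vec k m n h = x" by (simp only: h_def triple_vec_vec_triple[OF x])
  have "pair_norm (gcd_differential y h) = euclid_norm (0\<^sub>v ((m + 1) + (n + 1)))"
    using euclid_norm_pair_vec[OF gcd_differential_mem[OF y(1) h km kn]] Ax
    by (simp only: gcd_jacobian_mult[OF y(1) x] flip: h_def)
  then have "gcd_differential y h = 0"
    by (simp add: euclid_norm_def)
  moreover have "triple_cinner h (gauge_tangent y) = 0"
    using cscalar_prod_triple_vec[OF h] xh xe by simp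
  ultimately have "h = 0"
    using regular h by blast
  then have "euclid_norm x = 0"
    using euclid_norm_triple_vec[OF h] xh by simp
  then show ?thesis
    using euclid_norm_eq_0[of x] x by simp
qed

lemma jacobian_gauge:
  "gcd_jacobian k m n y d *\<^sub>v triple_vec k m n (gauge_tangent y) = 0\<^sub>v ((m + 1) + (n + 1))"
proof -
  have "gcd_jacobian k m n y d *\<^sub>v triple_vec k m n (gauge_tangent y) = pair_vec m n 0"
    by (simp only: gcd_jacobian_mult[OF y(1) triple_vec_carrier] gcd_differential_gauge
        vec_triple_triple_vec[OF gauge_mem[OF y(1)]])
  also have "\<dots> = 0\<^sub>v ((m + 1) + (n + 1))"
    by (rule eq_vecI) (auto simp: pair_vec_index carrier_vecD[OF pair_vec_carrier])
  finally show ?thesis .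
qed

lemma gauge_vec_neq_0: "triple_vec k m n (gauge_tangent y) \<noteq> 0\<^sub>v ((k + 1) + (m - k + 1) + (n - k + 1))"
proof
  assume "triple_vec k m n (gauge_tangent y) = 0\<^sub>v ((k + 1) + (m - k + 1) + (n - k + 1))"
  then have "triple_norm (gauge_tangent y) = 0"
    using euclid_norm_triple_vec[OF gauge_mem[OF y(1)]] by (simp add: euclid_norm_def)
  with y show False by (simp add: triple_norm_gauge)
qed

text \<open>The domain has dimension \<open>m + n - k + 3\<close>, and the kernel is the line
  spanned by the tangent; this is where the value of \<open>r\<close> comes from.\<close>

lemma rank_gcd_jacobian: "vec_space.rank ((m + 1) + (n + 1)) (gcd_jacobian k m n y d) = m + n - k + 2"
proof -
  have "vec_space.rank ((m + 1) + (n + 1)) (gcd_jacobian k m n y d) = (k + 1) + (m - k + 1) + (n - k + 1) - 1"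
    by (rule rank_one_dim_kernel[OF gcd_jacobian_carrier triple_vec_carrier gauge_vec_neq_0 jacobian_gauge])
       (rule jacobian_kernel)
  then show ?thesis
    using km kn by simp
qed

lemma rank_pinv_gcd_jacobian:
  "is_moore_penrose_inverse (gcd_jacobian k m n y d) (rank_pinv (m + n - k + 2) (gcd_jacobian k m n y d))"
proof -
  have "\<exists>X. is_moore_penrose_inverse (gcd_jacobian k m n y d) X"
    by (rule moore_penrose_exists[OF gcd_jacobian_carrier triple_vec_carrier gauge_vec_neq_0 jacobian_gauge])
       (rule jacobian_kernel)
  then obtain X where "is_moore_penrose_inverse (gcd_jacobian k m n y d) X" ..
  then show ?thesis
    by (simp only: rank_pinv_self[OF gcd_jacobian_carrier rank_gcd_jacobian])
qed

lemma rank_projection_gcd_jacobian: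
  "\<exists>!B. is_rank_projection (m + n - k + 2) (gcd_jacobian k m n y d) B"
  using is_rank_projection_self[of "gcd_jacobian k m n y d" "m + n - k + 2"]
    carrier_matD[OF gcd_jacobian_carrier[of k m n y d]] rank_gcd_jacobian by simp

text \<open>On the complement of the tangent the pseudoinverse is a left inverse:
  \<open>x - X (A x)\<close> lies in the kernel and is orthogonal to the tangent, hence zero. Thus
  the condition number becomes a coercivity constant.\<close>

lemma triple_norm_le_op_norm:
  assumes h: "h \<in> triple_space k m n" "triple_cinner h (gauge_tangent y) = 0"
  shows "triple_norm h \<le> op_norm (rank_pinv (m + n - k + 2) (gcd_jacobian k m n y d))
    * pair_norm (gcd_differential y h)"
proof -
  let ?N = "(k + 1) + (m - k + 1) + (n - k + 1)"
  define A where "A = gcd_jacobian k m n y d"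
  define X where "X = rank_pinv (m + n - k + 2) A"
  define x where "x = triple_vec k m n h"
  define e where "e = triple_vec k m n (gauge_tangent y)"
  have A: "A \<in> carrier_mat ((m + 1) + (n + 1)) ?N" by (simp only: A_def gcd_jacobian_carrier)
  have mp: "is_moore_penrose_inverse A X"
    unfolding A_def X_def by (rule rank_pinv_gcd_jacobian)
  then have X: "X \<in> carrier_mat ?N ((m + 1) + (n + 1))" and AXA: "A * X * A = A"
    using A by (auto simp: is_moore_penrose_inverse_def)
  have x: "x \<in> carrier_vec ?N" by (simp only: x_def triple_vec_carrier)
  have e: "e \<in> carrier_vec ?N" by (simp only: e_def triple_vec_carrier)
  have Ax: "A *\<^sub>v x \<in> carrier_vec ((m + 1) + (n + 1))" using A x by (rule mult_mat_vec_carrier)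
  have XAx: "X *\<^sub>v (A *\<^sub>v x) \<in> carrier_vec ?N" using X Ax by (rule mult_mat_vec_carrier)
  have "A *\<^sub>v (X *\<^sub>v (A *\<^sub>v x)) = A *\<^sub>v x"
    using AXA assoc_mult_mat_vec[OF A X Ax] assoc_mult_mat_vec[OF mult_carrier_mat[OF A X] A x] by simp
  then have "A *\<^sub>v (x - X *\<^sub>v (A *\<^sub>v x)) = A *\<^sub>v x - A *\<^sub>v x"
    by (simp only: mult_minus_distrib_mat_vec[OF A x XAx])
  then have 1: "A *\<^sub>v (x - X *\<^sub>v (A *\<^sub>v x)) = 0\<^sub>v ((m + 1) + (n + 1))"
    using minus_cancel_vec[OF Ax] by simp
  have "(X *\<^sub>v (A *\<^sub>v x)) \<bullet>c e = 0"
    using moore_penrose_orthogonal_kernel[OF A mp Ax e] jacobian_gauge by (simp only: A_def e_def)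
  moreover have "x \<bullet>c e = 0"
    using cscalar_prod_triple_vec[OF h(1)] h(2) by (simp add: x_def e_def)
  ultimately have 2: "(x - X *\<^sub>v (A *\<^sub>v x)) \<bullet>c e = 0"
    using minus_scalar_prod_distrib[OF x XAx carrier_vec_conjugate[OF e]] by simp
  have "x - X *\<^sub>v (A *\<^sub>v x) = 0\<^sub>v ?N"
    by (rule jacobian_kernel[of _ d]) (use 1 2 x XAx in \<open>simp_all only: A_def e_def minus_carrier_vec\<close>)
  then have "x = X *\<^sub>v (A *\<^sub>v x)"
    by (rule vec_eq_if_diff_eq_0[OF x XAx])
  then have "euclid_norm x \<le> op_norm X * euclid_norm (A *\<^sub>v x)"
    using euclid_norm_mult_le_op_norm[OF X Ax] by simp
  moreover have "euclid_norm x = triple_norm h"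
    by (simp only: x_def euclid_norm_triple_vec[OF h(1)])
  moreover have "A *\<^sub>v x = pair_vec m n (gcd_differential y h)"
    unfolding A_def x_def gcd_jacobian_mult[OF y(1) triple_vec_carrier] vec_triple_triple_vec[OF h(1)] ..
  ultimately show ?thesis
    using euclid_norm_pair_vec[OF gcd_differential_mem[OF y(1) h(1) km kn]] by (simp only: X_def A_def)
qed

text \<open>The pseudoinverse solves the normal equations, and its values are orthogonal to the
  tangent, which is what makes \<open>coercive\<close> applicable to the step.\<close>

lemma newton_step:
  assumes d: "d \<in> pair_space m n"
    and coercive: "\<And>h. h \<in> triple_space k m n \<Longrightarrow> triple_cinner h (gauge_tangent y) = 0 \<Longrightarrow>
      triple_norm h \<le> \<sigma> * pair_norm (gcd_differential y h)"
  shows "gcd.gauss_newton_step k m n d \<sigma> y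
    (- vec_triple k m n (rank_pinv (m + n - k + 2) (gcd_jacobian k m n y d) *\<^sub>v pair_vec m n (gcd_map y d)))"
proof -
  let ?N = "(k + 1) + (m - k + 1) + (n - k + 1)"
  define A where "A = gcd_jacobian k m n y d"
  define X where "X = rank_pinv (m + n - k + 2) A"
  define x where "x = pair_vec m n (gcd_map y d)"
  define h where "h = vec_triple k m n (X *\<^sub>v x)"
  have A: "A \<in> carrier_mat ((m + 1) + (n + 1)) ?N" by (simp only: A_def gcd_jacobian_carrier)
  have mp: "is_moore_penrose_inverse A X"
    unfolding A_def X_def by (rule rank_pinv_gcd_jacobian)
  then have X: "X \<in> carrier_mat ?N ((m + 1) + (n + 1))"
    using A by (auto simp: is_moore_penrose_inverse_def)
  have x: "x \<in> carrier_vec ((m + 1) + (n + 1))" by (simp only: x_def pair_vec_carrier)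
  have Xx: "X *\<^sub>v x \<in> carrier_vec ?N" using X x by (rule mult_mat_vec_carrier)
  have h: "h \<in> triple_space k m n" by (simp only: h_def vec_triple_mem)
  have res: "gcd_map y d \<in> pair_space m n"
    using gcd_product_mem[OF y(1) km kn] d
    by (auto simp: gcd_map_eq pair_space_def poly_space_def degree_diff_le mem_Times_iff)
  have "triple_cinner h (gauge_tangent y) = 0"
  proof -
    have "triple_vec k m n h \<bullet>c triple_vec k m n (gauge_tangent y) = 0"
      unfolding h_def triple_vec_vec_triple[OF Xx]
      by (rule moore_penrose_orthogonal_kernel[OF A mp x triple_vec_carrier]) (simp only: A_def jacobian_gauge)
    then show ?thesis
      using cscalar_prod_triple_vec[OF h] by simp
  qed
  moreover have "gcd_differential y (- h) = - gcd_differential y h" for h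
    using gcd_differential_diff_right[of y 0 h] gcd_differential_diff_right[of y 0 0] by simp
  moreover have "triple_cinner (- h) g = - triple_cinner h g" for h g
    using triple_cinner_diff_left[of 0 h g] triple_cinner_diff_left[of 0 0 g] by simp
  moreover have "pair_inner (gcd_map y d - gcd_differential y h) (gcd_differential y g) = 0"
    if g: "g \<in> triple_space k m n" for g
  proof -
    have D: "gcd_differential y g \<in> pair_space m n" "gcd_differential y h \<in> pair_space m n"
      using g h y km kn by (auto intro: gcd_differential_mem)
    have Ag: "A *\<^sub>v triple_vec k m n g = pair_vec m n (gcd_differential y g)"
      unfolding A_def gcd_jacobian_mult[OF y(1) triple_vec_carrier] vec_triple_triple_vec[OF g] ..
    have "A *\<^sub>v (X *\<^sub>v x) = pair_vec m n (gcd_differential y h)"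
      unfolding A_def gcd_jacobian_mult[OF y(1) Xx] h_def ..
    then have "pair_cinner (gcd_differential y h) (gcd_differential y g) = pair_cinner (gcd_map y d) (gcd_differential y g)"
      using moore_penrose_normal_equation[OF A mp x triple_vec_carrier, of g]
      by (simp only: Ag x_def cscalar_prod_pair_vec[OF D(2)] cscalar_prod_pair_vec[OF res])
    then show ?thesis
      unfolding pair.ip_diff_left unfolding pair_inner_eq_Re by simp
  qed
  ultimately have "gcd.gauss_newton_step k m n d \<sigma> y (- h)"
    unfolding gcd.gauss_newton_step_def
    using h coercive[of h] by (simp add: gcd.minus_mem gcd_map_eq)
  then show ?thesis
    by (simp only: h_def x_def X_def A_def)
qed

end

section \<open>Exact greatest common divisors\<close>

text \<open>The kernel equations show that \<open>u\<close> divides \<open>a * v\<close> and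
  \<open>a * w\<close>, hence \<open>a\<close>, as \<open>v\<close> and \<open>w\<close> are
  coprime. By degrees \<open>a = t u\<close>, and cancelling \<open>u\<close> gives
  \<open>b = - t v\<close> and \<open>c = - t w\<close>. So \<open>h\<close> is a multiple of the
  tangent, and orthogonality makes it zero.\<close>

lemma gcd_zero_regular:
  assumes z: "(u, v, w) \<in> triple_space k m n" and u: "degree u = k" "u \<noteq> 0" and cop: "coprime v w"
    and h: "h \<in> triple_space k m n" and orth: "triple_cinner h (gauge_tangent (u, v, w)) = 0"
    and kernel: "gcd_differential (u, v, w) h = 0"
  shows "h = 0"
proof -
  obtain a b c where h_eq: "h = (a, b, c)" by (cases h)
  have eq: "u * b + a * v = 0" "u * c + a * w = 0"
    using kernel by (simp_all add: h_eq zero_prod_def)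
  have "u dvd a * v" "u dvd a * w"
    using eq by (metis add_eq_0_iff dvd_minus_iff dvd_triv_left)+
  then have "u dvd gcd (a * v) (a * w)"
    by (rule gcd_greatest)
  also have "gcd (a * v) (a * w) dvd a"
    using cop by (simp add: gcd_mult_left coprime_iff_gcd_eq_1)
  finally obtain s where s: "a = u * s" ..
  have "degree a \<le> k"
    using h by (simp add: h_eq triple_space_def poly_space_def)
  then have "degree s = 0"
    using u by (cases "s = 0") (auto simp: s degree_mult_eq)
  then obtain t where t: "s = [:t:]"
    by (metis degree_eq_zeroE)
  have a: "a = Polynomial.smult t u"
    by (simp add: s t)
  have "u * (b + Polynomial.smult t v) = 0" "u * (c + Polynomial.smult t w) = 0"
    using eq by (simp_all add: a algebra_simps)
  then have "b = - Polynomial.smult t v" "c = - Polynomial.smult t w"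
    using u by (auto simp: add_eq_0_iff2)
  then have h_gauge: "h = triple_smult t (gauge_tangent (u, v, w))"
    by (simp add: h_eq a)
  then have "t * of_real ((triple_norm (gauge_tangent (u, v, w)))\<^sup>2) = 0"
    using orth by (simp only: triple_cinner_smult_left triple_cinner_self)
  then have "t = 0"
    using u by (simp add: triple_norm_gauge zero_prod_def del: triple_norm.simps gauge_tangent.simps)
  then show ?thesis
    by (simp add: h_gauge zero_prod_def)
qed

text \<open>The degrees of \<open>u\<close> and \<open>v\<close> add up to \<open>m\<close> and are
  bounded by \<open>k\<close> and \<open>m - k\<close>, so both bounds are attained. Then
  \<open>u\<close> divides the gcd and has the same degree, so the quotient is a constant. A common
  divisor \<open>x\<close> of the cofactors makes \<open>u * x\<close> divide a multiple of
  \<open>u\<close> by a unit, so \<open>x\<close> is a unit.\<close>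

lemma gcd_zeros_props:
  assumes pq: "p \<noteq> 0" "q \<noteq> 0" "degree p = m" "degree q = n" "degree (gcd p q) = k"
    and z: "(u, v, w) \<in> gcd_zeros k m n (p, q)"
  shows "(u, v, w) \<in> triple_space k m n" "p = u * v" "q = u * w" "u \<noteq> 0" "degree u = k" "coprime v w"
    "\<exists>a. a \<noteq> 0 \<and> u = Polynomial.smult a (gcd p q)"
proof -
  show mem: "(u, v, w) \<in> triple_space k m n" and p: "p = u * v" and q: "q = u * w"
    using z by (auto simp: gcd_zeros_def)
  show u: "u \<noteq> 0" using p pq by auto
  have v: "v \<noteq> 0" and w: "w \<noteq> 0" using p q pq by auto
  have g: "gcd p q \<noteq> 0" using pq by simp
  have "k \<le> m"
    using dvd_imp_degree_le[of "gcd p q" p] pq by simp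
  moreover have "degree u \<le> k" "degree v \<le> m - k"
    using mem by (auto simp: triple_space_def poly_space_def)
  moreover have "degree u + degree v = m"
    using pq u v by (simp add: p degree_mult_eq)
  ultimately show deg_u: "degree u = k"
    by linarith
  have "u dvd gcd p q"
    by (simp add: p q)
  then obtain s where s: "gcd p q = u * s" ..
  then have "s \<noteq> 0" using g by auto
  then have "degree s = 0"
    using pq(5) u deg_u by (simp add: s degree_mult_eq)
  then obtain t where t: "s = [:t:]"
    by (metis degree_eq_zeroE)
  with \<open>s \<noteq> 0\<close> have t0: "t \<noteq> 0" by simp
  have gt: "gcd p q = Polynomial.smult t u" by (simp add: s t)
  then have "u = Polynomial.smult (1 / t) (gcd p q)"
    using t0 by simp
  with t0 show "\<exists>a. a \<noteq> 0 \<and> u = Polynomial.smult a (gcd p q)"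
    by (metis divide_eq_0_iff one_neq_zero)
  show "coprime v w"
  proof (rule coprimeI)
    fix x assume "x dvd v" "x dvd w"
    then have "u * x dvd gcd p q"
      by (simp add: p q mult_dvd_mono)
    then have "u * x dvd u * [:t:]"
      by (simp add: gt)
    then have "x dvd [:t:]"
      unfolding dvd_mult_cancel_left using u by blast
    moreover have "is_unit [:t:]"
      using t0 by (simp add: is_unit_const_poly_iff dvd_field_iff)
    ultimately show "is_unit x"
      by (rule dvd_trans)
  qed
qed

text \<open>Quantifying \<open>c\<close> before the polynomials expresses moderate magnitude as an
  absolute constant. The triple \<open>z_check\<close> may depend on the data and the initial
  iterate. Uniqueness of the rank projection at the zero makes the condition number independent of
  any choice.\<close>

theorem theorem2:
  shows "\<exists>c>0. \<forall>(p :: complex poly) (q :: complex poly) (m :: nat) (n :: nat) (k :: nat) (r :: nat).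
    p \<noteq> 0 \<and> q \<noteq> 0 \<and> degree p = m \<and> degree q = n \<and> degree (gcd p q) = k \<and> r = m + n - k + 2 \<longrightarrow>
    (\<forall>z_hat \<in> gcd_zeros k m n (p, q).
       (\<exists>!B. is_rank_projection r (gcd_jacobian k m n z_hat (p, q)) B) \<and>
       gcd_condition_number (p, q) z_hat = op_norm (rank_pinv r (gcd_jacobian k m n z_hat (p, q))) \<and>
       (\<exists>\<delta>>0. \<exists>C :: real.
          \<forall>d \<in> pair_space m n. \<forall>z0 \<in> triple_space k m n.
            pair_norm (d - (p, q)) < \<delta> \<longrightarrow> triple_norm (z0 - z_hat) < \<delta> \<longrightarrow>
            (\<exists>z_tilde \<in> triple_space k m n.
               triple_converges (newton_iterate r k m n d z0) z_tilde \<and>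
               (\<exists>z_check \<in> gcd_zeros k m n (p, q).
                  exact_gcd_triple (p, q) z_check \<and>
                  triple_norm (z_tilde - z_check)
                    \<le> c * op_norm (rank_pinv r (gcd_jacobian k m n z_hat (p, q)))
                        * pair_norm (d - (p, q))
                      + C * (pair_norm (d - (p, q)))\<^sup>2) \<and>
               (d = (p, q) \<longrightarrow> quadratic_rate (newton_iterate r k m n d z0) z_tilde))))"
proof (rule exI[of _ 2], intro conjI allI impI ballI)
  fix p q :: "complex poly" and m n k r :: nat and z
  assume asm: "p \<noteq> 0 \<and> q \<noteq> 0 \<and> degree p = m \<and> degree q = n \<and> degree (gcd p q) = k \<and> r = m + n - k + 2"
    and z: "z \<in> gcd_zeros k m n (p, q)"
  have pq: "p \<noteq> 0" "q \<noteq> 0" "degree p = m" "degree q = n" "degree (gcd p q) = k" and r: "r = m + n - k + 2"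
    using asm by auto
  have km: "k \<le> m" and kn: "k \<le> n"
    using dvd_imp_degree_le[of "gcd p q" p] dvd_imp_degree_le[of "gcd p q" q] pq by auto
  obtain u v w where zu: "z = (u, v, w)" by (cases z)
  note props = gcd_zeros_props[OF pq z[unfolded zu]]
  have zV: "z \<in> triple_space k m n" and u: "fst z \<noteq> 0" and z0: "z \<noteq> 0" and prod: "gcd_product z = (p, q)"
    using props by (auto simp: zu zero_prod_def)
  have regular: "h = 0" if "h \<in> triple_space k m n" "triple_cinner h (gauge_tangent z) = 0" "gcd_differential z h = 0" for h
    using gcd_zero_regular[OF props(1,5,4,6)] that by (simp only: zu)
  show "\<exists>!B. is_rank_projection r (gcd_jacobian k m n z (p, q)) B"
    unfolding r by (rule rank_projection_gcd_jacobian[OF km kn zV z0 regular])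
  show "gcd_condition_number (p, q) z = op_norm (rank_pinv r (gcd_jacobian k m n z (p, q)))"
    by (simp add: pq r Let_def)
  define \<kappa> where "\<kappa> = op_norm (rank_pinv r (gcd_jacobian k m n z (p, q)))"
  have coercive: "triple_norm h \<le> \<kappa> * pair_norm (gcd_differential z h)"
    if "h \<in> triple_space k m n" "triple_cinner h (gauge_tangent z) = 0" for h
    unfolding \<kappa>_def r by (rule triple_norm_le_op_norm[OF km kn zV z0 regular that])
  have \<kappa>: "0 < \<kappa>"
  proof -
    \<comment> \<open>This value makes \<open>h\<close> orthogonal to the tangent
      \<open>(u, - v, - w)\<close>; a nonzero vector in the complement forces the coercivity
      constant to be positive.\<close>
    define t where "t = ((poly_norm v)\<^sup>2 + (poly_norm w)\<^sup>2) / (poly_norm u)\<^sup>2"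
    define h where "h = (Polynomial.smult (of_real t) u, v, w)"
    have h: "h \<in> triple_space k m n"
      using props(1) by (auto simp: h_def triple_space_def poly_space_def intro: order_trans[OF degree_smult_le])
    have "v \<noteq> 0" using props(2) pq by auto
    then have "0 < triple_norm h"
      by (simp add: h_def zero_prod_def del: triple_norm.simps)
    moreover have "t * (poly_norm u)\<^sup>2 = (poly_norm v)\<^sup>2 + (poly_norm w)\<^sup>2"
      using props(4) by (simp add: t_def)
    then have "complex_of_real t * of_real ((poly_norm u)\<^sup>2) = of_real ((poly_norm v)\<^sup>2 + (poly_norm w)\<^sup>2)"
      by (simp only: of_real_mult[symmetric])
    then have "triple_cinner h (gauge_tangent z) = 0"
      by (simp add: h_def zu triple_cinner_def poly_cinner_smult_left poly_cinner_minus_right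
          poly_cinner_self)
    ultimately have "0 < \<kappa> * pair_norm (gcd_differential z h)"
      using coercive[OF h] by linarith
    then show ?thesis
      using pair.nrm_ge_0[of "gcd_differential z h"] by (metis zero_less_mult_pos2 less_le mult_zero_right)
  qed
  define H where "H d y = - vec_triple k m n (rank_pinv r (gcd_jacobian k m n y d) *\<^sub>v pair_vec m n (gcd_map y d))"
    for d y
  have "\<exists>\<delta>>0. \<forall>d\<in>pair_space m n. \<forall>s. s 0 \<in> triple_space k m n \<longrightarrow> (\<forall>j. s (Suc j) = s j + H d (s j)) \<longrightarrow>
    pair_norm (d - (p, q)) < \<delta> \<longrightarrow> triple_norm (s 0 - z) < \<delta> \<longrightarrow>
    (\<exists>x\<in>triple_space k m n. triple_converges s x \<and>
      (\<exists>t. t \<noteq> 0 \<and> triple_norm (x - gauge_orbit t z) \<le> 2 * \<kappa> * pair_norm (d - (p, q))) \<and>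
      (d = (p, q) \<longrightarrow> quadratic_rate s x))"
  proof (rule gcd_newton_converges[OF zV u prod \<kappa> coercive])
    fix d y
    assume y: "y \<in> triple_space k m n" "y \<noteq> 0" and d: "d \<in> pair_space m n"
      and co: "\<And>h. h \<in> triple_space k m n \<Longrightarrow> triple_cinner h (gauge_tangent y) = 0 \<Longrightarrow>
        triple_norm h \<le> 3 / 2 * \<kappa> * pair_norm (gcd_differential y h)"
    have "h = 0" if "h \<in> triple_space k m n" "triple_cinner h (gauge_tangent y) = 0" "gcd_differential y h = 0" for h
      using co[OF that(1,2)] that(3) triple.nrm_ge_0[of h] by (metis antisym mult_zero_right pair.nrm_zero triple.nrm_eq_0)
    then show "gcd.gauss_newton_step k m n d (3 / 2 * \<kappa>) y (H d y)"
      unfolding H_def r using newton_step[OF km kn y _ d co] by blast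
  qed
  then obtain \<delta> where \<delta>: "0 < \<delta>" and conv: "\<And>d s. d \<in> pair_space m n \<Longrightarrow> s 0 \<in> triple_space k m n \<Longrightarrow>
    (\<forall>j. s (Suc j) = s j + H d (s j)) \<Longrightarrow>
    pair_norm (d - (p, q)) < \<delta> \<Longrightarrow> triple_norm (s 0 - z) < \<delta> \<Longrightarrow>
    (\<exists>x\<in>triple_space k m n. triple_converges s x \<and>
      (\<exists>t. t \<noteq> 0 \<and> triple_norm (x - gauge_orbit t z) \<le> 2 * \<kappa> * pair_norm (d - (p, q))) \<and>
      (d = (p, q) \<longrightarrow> quadratic_rate s x))"
    by blast
  have gauge_orbit: "gauge_orbit t z \<in> gcd_zeros k m n (p, q)" "exact_gcd_triple (p, q) (gauge_orbit t z)" if "t \<noteq> 0" for t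
  proof -
    show "gauge_orbit t z \<in> gcd_zeros k m n (p, q)"
      using orbit_mem[OF zV] gcd_product_orbit[OF that, of z] prod
      by (simp add: gcd_zeros_def gcd_map_eq zero_prod_def)
    obtain a where "a \<noteq> 0" "u = Polynomial.smult a (gcd p q)"
      using props(7) by blast
    then have "t * a \<noteq> 0 \<and> Polynomial.smult t u = Polynomial.smult (t * a) (gcd p q)"
      using that by simp
    then have "\<exists>a. a \<noteq> 0 \<and> Polynomial.smult t u = Polynomial.smult a (gcd p q)" ..
    then show "exact_gcd_triple (p, q) (gauge_orbit t z)"
      using that props(2,3) by (simp add: zu)
  qed
  \<comment> \<open>The coefficient \<open>C\<close> is taken to be zero, because the bound obtained
    is already linear in the data error.\<close>
  show "\<exists>\<delta>>0. \<exists>C. \<forall>d\<in>pair_space m n. \<forall>z0\<in>triple_space k m n.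
      pair_norm (d - (p, q)) < \<delta> \<longrightarrow> triple_norm (z0 - z) < \<delta> \<longrightarrow>
      (\<exists>z_tilde\<in>triple_space k m n. triple_converges (newton_iterate r k m n d z0) z_tilde \<and>
        (\<exists>z_check\<in>gcd_zeros k m n (p, q). exact_gcd_triple (p, q) z_check \<and>
          triple_norm (z_tilde - z_check)
            \<le> 2 * op_norm (rank_pinv r (gcd_jacobian k m n z (p, q))) * pair_norm (d - (p, q))
              + C * (pair_norm (d - (p, q)))\<^sup>2) \<and>
        (d = (p, q) \<longrightarrow> quadratic_rate (newton_iterate r k m n d z0) z_tilde))"
  proof (rule exI[of _ \<delta>], intro conjI \<delta> exI[of _ 0] ballI impI)
    fix d z0
    assume d: "d \<in> pair_space m n" and z0: "z0 \<in> triple_space k m n"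
      and near: "pair_norm (d - (p, q)) < \<delta>" "triple_norm (z0 - z) < \<delta>"
    obtain x t where x: "x \<in> triple_space k m n" "triple_converges (newton_iterate r k m n d z0) x" "t \<noteq> 0"
      "triple_norm (x - gauge_orbit t z) \<le> 2 * \<kappa> * pair_norm (d - (p, q))"
      "d = (p, q) \<longrightarrow> quadratic_rate (newton_iterate r k m n d z0) x"
      using conv[OF d, of "newton_iterate r k m n d z0"] z0 near by (auto simp: H_def Let_def)
    then show "\<exists>z_tilde\<in>triple_space k m n. triple_converges (newton_iterate r k m n d z0) z_tilde \<and>
        (\<exists>z_check\<in>gcd_zeros k m n (p, q). exact_gcd_triple (p, q) z_check \<and>
          triple_norm (z_tilde - z_check)
            \<le> 2 * op_norm (rank_pinv r (gcd_jacobian k m n z (p, q))) * pair_norm (d - (p, q))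
              + 0 * (pair_norm (d - (p, q)))\<^sup>2) \<and>
        (d = (p, q) \<longrightarrow> quadratic_rate (newton_iterate r k m n d z0) z_tilde)"
      using gauge_orbit[OF x(3)] by (intro bexI[of _ x] conjI bexI[of _ "gauge_orbit t z"]) (auto simp: \<kappa>_def)
  qed
qed simp

end
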